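(* Let $n\ge 0$ be an integer. Let $M_1$ and $M_2$ be compact oriented homotopy equivalent manifolds without boundary. Let $\mathcal S_i=\{S_0^i,\ldots,S_{n+1}^i\}$, $i=1,2$, be covers of $M_i$ such that the intersection of all the subsets in $\mathcal S_i$ is empty for $i=1,2$. Then $[\mathcal S_1]_C=[\mathcal S_2]_C$ (that is, $\mathcal S_1$ is cobordant to $\mathcal S_2$ as a cover) if and only if $[f_{\mathcal S_1}]_C=[f_{\mathcal S_2}]_C$ in $\Omega_*^{SO}(S^n)$.
   Context: A family of sets $\mathcal S=\{S_0,\ldots,S_{n+1}\}$ (indexed by $0,\ldots,n+1$) is called a cover of a space $T$ if it is either an open cover or a closed cover of $T$. Associated maps. Let $v_0,\ldots,v_{n+1}$ be the vertices of an $(n+1)$-simplex $\Delta^{n+1}$ in $\mathbb{R}^{n+1}$, and identify $S^n$ with the boundary $\partial\Delta^{n+1}$. Let $\mathcal U=\{U_0,\ldots,U_{n+1}\}$ be an open cover of a normal space $T$ with $\bigcap_i U_i=\emptyset$, and let $\Phi=\{\varphi_0,\ldots,\varphi_{n+1}\}$ be a partition of unity subordinate to $\mathcal U$. Then $f_{\mathcal U,\Phi}(x):=\sum_{i=0}^{n+1}\varphi_i(x)v_i$ is a continuous map $T\to\partial\Delta^{n+1}=S^n$, whose homotopy class does not depend on $\Phi$ and is denoted $[f_{\mathcal U}]$. For a closed cover $\mathcal S=\{S_0,\ldots,S_{n+1}\}$ of $T$ with $\bigcap_i S_i=\emptyset$, $[f_{\mathcal S}]:=[f_{\mathcal U}]$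 for any open cover $\mathcal U=\{U_0,\ldots,U_{n+1}\}$ with $S_i\subset U_i$ for all $i$ and $\bigcap_i U_i=\emptyset$ (such $\mathcal U$ exists and the class does not depend on its choice). Cobordism of maps. For compact oriented manifolds $M_1,M_2$ without boundary of the same dimension, continuous maps $f_i:M_i\to X$ are cobordant, written $[f_1]_C=[f_2]_C$ in the group $\Omega_*^{SO}(X)$ of oriented cobordism classes of maps to $X$, if there are a compact oriented manifold $W$ with oriented boundary $\partial W=M_1\sqcup(-M_2)$ (where $-M_2$ is $M_2$ with reversed orientation) and a continuous map $F:W\to X$ with $F|_{M_i}=f_i$ for $i=1,2$. Homotopic maps are cobordant, so $[f_{\mathcal S}]_C$ is well defined from $[f_{\mathcal S}]$. Cobordism of covers. Let $M_1,M_2$ be compact oriented manifolds without boundary with $\dim M_1=\dim M_2$, and let $\mathcal S_i=\{S_0^i,\ldots,S_{n+1}^i\}$ be covers of $M_i$, each with empty intersection of all its members. One says that $\mathcal S_1$ is cobordant to $\mathcal S_2$, and writes $[\mathcal S_1]_C=[\mathcal S_2]_C$, if there are a compact oriented manifold $W$ with oriented boundary $\partial W=M_1\sqcup(-M_2)$ and a cover $\mathcal Q=\{Q_0,\ldots,Q_{n+1}\}$ of $W$ such that $\mathcal Q|_{M_i}=\mathcal S_i$ for $i=1,2$ (i.e. $Q_k\cap M_i=S_k^i$ for all $k$) and $\bigcap_k Q_k=\emptyset$.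
   Formalization: The two covers are assumed to be both open or both closed; for one open and one closed cover the "if" direction fails (two open arcs versus two closed arcs on the circle, n = 1, third set empty). *)

theory Defs
  imports "HOL-Analysis.Analysis"
begin

section \<open>Smooth maps between subsets of Euclidean spaces\<close>

text \<open>
  The model of \<open>m\<close>-space is the topology \<^const>\<open>Euclidean_space\<close> \<open>m\<close>, whose points are
  the functions \<^typ>\<open>nat \<Rightarrow> real\<close> vanishing from index \<open>m\<close> on.
  Manifolds of dimension 0 are included.
\<close>

definition half_space :: "nat \<Rightarrow> (nat \<Rightarrow> real) set" where
  "half_space m = {x \<in> topspace (Euclidean_space m). 0 < m \<longrightarrow> 0 \<le> x 0}"

text \<open>
  The derivative is taken within the slice of \<open>A\<close> through \<open>x\<close>, so that it is the usual partial
  derivative if \<open>A\<close> is open, and one-sided at boundary points of a half space.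
\<close>

definition partial_deriv ::
    "(nat \<Rightarrow> real) set \<Rightarrow> nat \<Rightarrow> ((nat \<Rightarrow> real) \<Rightarrow> real) \<Rightarrow> (nat \<Rightarrow> real) \<Rightarrow> real" where
  "partial_deriv A i g x =
     vector_derivative (\<lambda>t. g (x(i := t))) (at (x i) within {t. x(i := t) \<in> A})"

fun iterated_partial ::
    "(nat \<Rightarrow> real) set \<Rightarrow> nat list \<Rightarrow> ((nat \<Rightarrow> real) \<Rightarrow> real) \<Rightarrow> (nat \<Rightarrow> real) \<Rightarrow> real" where
  "iterated_partial A [] g = g"
| "iterated_partial A (i # is) g = partial_deriv A i (iterated_partial A is g)"

text \<open>\<open>C\<^sup>\<infinity>\<close> on an open set \<open>D\<close>: all iterated partial derivatives exist and are continuous.\<close>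

definition smooth_fun :: "nat \<Rightarrow> (nat \<Rightarrow> real) set \<Rightarrow> ((nat \<Rightarrow> real) \<Rightarrow> real) \<Rightarrow> bool" where
  "smooth_fun m D g \<longleftrightarrow>
     (\<forall>is. set is \<subseteq> {..<m} \<longrightarrow>
        continuous_map (subtopology (Euclidean_space m) D) euclideanreal (iterated_partial D is g) \<and>
        (\<forall>i<m. \<forall>x\<in>D. (\<lambda>t. iterated_partial D is g (x(i := t)))
                        differentiable (at (x i) within {t. x(i := t) \<in> D})))"

text \<open>On an arbitrary subset \<open>A\<close>, smooth means locally the restriction of a smooth map on an open set.\<close>

definition smooth_map_on ::
    "nat \<Rightarrow> (nat \<Rightarrow> real) set \<Rightarrow> ((nat \<Rightarrow> real) \<Rightarrow> nat \<Rightarrow> real) \<Rightarrow> bool" where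
  "smooth_map_on m A f \<longleftrightarrow>
     (\<forall>p\<in>A. \<exists>D g. openin (Euclidean_space m) D \<and> p \<in> D \<and>
        (\<forall>j<m. smooth_fun m D (\<lambda>x. g x j)) \<and>
        (\<forall>x\<in>A \<inter> D. \<forall>j<m. g x j = f x j))"

text \<open>
  The Leibniz formula, as in \<^const>\<open>Determinants.det\<close>, whose matrices have a type as index set and
  so neither a variable size nor size 0 (where the determinant is 1).
\<close>

definition jacobian_det ::
    "nat \<Rightarrow> (nat \<Rightarrow> real) set \<Rightarrow> ((nat \<Rightarrow> real) \<Rightarrow> nat \<Rightarrow> real) \<Rightarrow> (nat \<Rightarrow> real) \<Rightarrow> real" where
  "jacobian_det m A f x =
     (\<Sum>p | p permutes {..<m}. of_int (sign p) * (\<Prod>j<m. partial_deriv A (p j) (\<lambda>y. f y j) x))"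


section \<open>Oriented manifolds with boundary\<close>

text \<open>
  A chart is a triple \<open>(U, c, s)\<close>: a domain, a coordinate map, and a sign function on the domain.
  The sign is \<open>1\<close> where the standard orientation of \<open>m\<close>-space, transported by \<open>c\<close>, is the chosen
  orientation, and \<open>-1\<close> where it is the opposite one.  Asking instead that all transition
  determinants be positive would give each 0-manifold a single orientation, and would leave a
  closed interval with none when charts take values in the half space \<open>x 0 \<ge> 0\<close>.
\<close>

type_synonym 'a chart = "'a set \<times> ('a \<Rightarrow> nat \<Rightarrow> real) \<times> ('a \<Rightarrow> real)"

record 'a mfd =
  mdim :: nat
  mtop :: "'a topology"
  charts :: "'a chart set"

abbreviation mcarrier :: "'a mfd \<Rightarrow> 'a set" where
  "mcarrier M \<equiv> topspace (mtop M)"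

fun is_chart :: "nat \<Rightarrow> 'a topology \<Rightarrow> 'a chart \<Rightarrow> bool" where
  "is_chart m X (U, c, s) \<longleftrightarrow>
     openin X U \<and>
     homeomorphic_map (subtopology X U) (subtopology (Euclidean_space m) (c ` U)) c \<and>
     (openin (Euclidean_space m) (c ` U) \<or>
      openin (subtopology (Euclidean_space m) (half_space m)) (c ` U)) \<and>
     continuous_map (subtopology X U) euclideanreal s \<and> s ` U \<subseteq> {1, -1}"

text \<open>
  The map \<open>e\<close>, read in the two charts, is smooth and preserves orientation; since \<open>s x\<close> is nonzero,
  the Jacobian determinant is too.
\<close>

fun oriented_in_charts :: "nat \<Rightarrow> ('a \<Rightarrow> 'b) \<Rightarrow> 'a chart \<Rightarrow> 'b chart \<Rightarrow> bool" where
  "oriented_in_charts m e (U, c, s) (U', c', s') \<longleftrightarrow>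
     (let A = c ` (U \<inter> e -` U'); g = (\<lambda>y. c' (e (inv_into U c y)))
      in smooth_map_on m A g \<and>
         (\<forall>x \<in> U \<inter> e -` U'. s x = sgn (jacobian_det m A g (c x)) * s' (e x)))"

definition oriented_manifold :: "'a mfd \<Rightarrow> bool" where
  "oriented_manifold M \<longleftrightarrow>
     Hausdorff_space (mtop M) \<and> second_countable (mtop M) \<and>
     (\<forall>ch \<in> charts M. is_chart (mdim M) (mtop M) ch) \<and>
     (\<Union>ch \<in> charts M. fst ch) = mcarrier M \<and>
     (\<forall>ch \<in> charts M. \<forall>ch' \<in> charts M. oriented_in_charts (mdim M) (\<lambda>x. x) ch ch')"

definition mboundary :: "'a mfd \<Rightarrow> 'a set" where
  "mboundary M = {x. \<exists>(U, c, s) \<in> charts M.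
      x \<in> U \<and> c ` U \<subseteq> half_space (mdim M) \<and> 0 < mdim M \<and> c x 0 = 0}"

definition compact_oriented_manifold :: "'a mfd \<Rightarrow> bool" where
  "compact_oriented_manifold M \<longleftrightarrow> oriented_manifold M \<and> compact_space (mtop M)"

definition reverse_orientation :: "'a mfd \<Rightarrow> 'a mfd" where
  "reverse_orientation M = M\<lparr>charts := (\<lambda>(U, c, s). (U, c, \<lambda>x. - s x)) ` charts M\<rparr>"

text \<open>
  Boundary orientation by the outward-normal-first convention: in the half space \<open>x 0 \<ge> 0\<close> the
  outward normal is minus the first basis vector, so dropping the coordinate \<open>x 0\<close> changes the sign.
\<close>

definition boundary_mfd :: "'a mfd \<Rightarrow> 'a mfd" where
  "boundary_mfd W =
     \<lparr>mdim = mdim W - 1,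
      mtop = subtopology (mtop W) (mboundary W),
      charts = (\<lambda>(U, c, s). (U \<inter> mboundary W, \<lambda>x i. c x (Suc i), \<lambda>x. - s x)) ` charts W\<rparr>"

text \<open>
  For manifolds without boundary and of equal dimension, such an \<open>e\<close> is an orientation preserving
  diffeomorphism onto an open submanifold (inverse function theorem).
\<close>

definition oriented_embedding :: "'a mfd \<Rightarrow> 'b mfd \<Rightarrow> ('a \<Rightarrow> 'b) \<Rightarrow> bool" where
  "oriented_embedding M N e \<longleftrightarrow>
     mdim M = mdim N \<and> embedding_map (mtop M) (mtop N) e \<and>
     (\<forall>ch \<in> charts M. \<forall>ch' \<in> charts N. oriented_in_charts (mdim M) e ch ch')"


section \<open>Cobordism of maps\<close>

text \<open>
  \<open>\<partial>W = M1 \<squnion> (-M2)\<close>, the identification being given by \<open>e1\<close> and \<open>e2\<close>.  The points of \<open>W\<close> are taken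
  in the type \<^typ>\<open>nat \<Rightarrow> real\<close>, with an arbitrary topology; as a second countable Hausdorff space
  has at most continuum many points, this does not restrict \<open>W\<close>.
\<close>

definition cobordism ::
    "(nat \<Rightarrow> real) mfd \<Rightarrow> 'a mfd \<Rightarrow> ('a \<Rightarrow> nat \<Rightarrow> real) \<Rightarrow> 'b mfd \<Rightarrow> ('b \<Rightarrow> nat \<Rightarrow> real) \<Rightarrow> bool" where
  "cobordism W M1 e1 M2 e2 \<longleftrightarrow>
     compact_oriented_manifold W \<and>
     mdim W = Suc (mdim M1) \<and> mdim W = Suc (mdim M2) \<and>
     oriented_embedding M1 (boundary_mfd W) e1 \<and>
     oriented_embedding (reverse_orientation M2) (boundary_mfd W) e2 \<and>
     e1 ` mcarrier M1 \<inter> e2 ` mcarrier M2 = {} \<and>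
     e1 ` mcarrier M1 \<union> e2 ` mcarrier M2 = mboundary W"

definition cobordant_maps ::
    "'y topology \<Rightarrow> 'a mfd \<Rightarrow> ('a \<Rightarrow> 'y) \<Rightarrow> 'b mfd \<Rightarrow> ('b \<Rightarrow> 'y) \<Rightarrow> bool" where
  "cobordant_maps Y M1 f1 M2 f2 \<longleftrightarrow>
     (\<exists>W e1 e2 F. cobordism W M1 e1 M2 e2 \<and> continuous_map (mtop W) Y F \<and>
        (\<forall>x \<in> mcarrier M1. F (e1 x) = f1 x) \<and>
        (\<forall>x \<in> mcarrier M2. F (e2 x) = f2 x))"


section \<open>Covers and cobordism of covers\<close>

text \<open>A family indexed by \<open>0, \<dots>, n + 1\<close> is a function on \<^typ>\<open>nat\<close> looked at on \<open>{..Suc n}\<close> only.\<close>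

definition open_cover :: "nat \<Rightarrow> 'a topology \<Rightarrow> (nat \<Rightarrow> 'a set) \<Rightarrow> bool" where
  "open_cover n X S \<longleftrightarrow> (\<forall>i\<le>Suc n. openin X (S i)) \<and> (\<Union>i\<le>Suc n. S i) = topspace X"

definition closed_cover :: "nat \<Rightarrow> 'a topology \<Rightarrow> (nat \<Rightarrow> 'a set) \<Rightarrow> bool" where
  "closed_cover n X S \<longleftrightarrow> (\<forall>i\<le>Suc n. closedin X (S i)) \<and> (\<Union>i\<le>Suc n. S i) = topspace X"

definition is_cover :: "nat \<Rightarrow> 'a topology \<Rightarrow> (nat \<Rightarrow> 'a set) \<Rightarrow> bool" where
  "is_cover n X S \<longleftrightarrow> open_cover n X S \<or> closed_cover n X S"

definition cobordant_covers ::
    "nat \<Rightarrow> 'a mfd \<Rightarrow> (nat \<Rightarrow> 'a set) \<Rightarrow> 'b mfd \<Rightarrow> (nat \<Rightarrow> 'b set) \<Rightarrow> bool" where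
  "cobordant_covers n M1 S1 M2 S2 \<longleftrightarrow>
     (\<exists>W e1 e2 Q. cobordism W M1 e1 M2 e2 \<and> is_cover n (mtop W) Q \<and>
        (\<forall>k\<le>Suc n. {x \<in> mcarrier M1. e1 x \<in> Q k} = S1 k) \<and>
        (\<forall>k\<le>Suc n. {x \<in> mcarrier M2. e2 x \<in> Q k} = S2 k) \<and>
        (\<Inter>k\<le>Suc n. Q k) = {})"


section \<open>The homotopy class associated with a cover\<close>

definition simplex_vertices :: "nat \<Rightarrow> (nat \<Rightarrow> nat \<Rightarrow> real) \<Rightarrow> bool" where
  "simplex_vertices n v \<longleftrightarrow>
     (\<forall>i\<le>Suc n. v i \<in> topspace (Euclidean_space (Suc n))) \<and>
     (\<forall>a :: nat \<Rightarrow> real. (\<Sum>i\<le>Suc n. a i) = 0 \<and> (\<forall>j. (\<Sum>i\<le>Suc n. a i * v i j) = 0) \<longrightarrow>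
        (\<forall>i\<le>Suc n. a i = 0))"

definition sphere_top :: "nat \<Rightarrow> (nat \<Rightarrow> nat \<Rightarrow> real) \<Rightarrow> (nat \<Rightarrow> real) topology" where
  "sphere_top n v = subtopology (Euclidean_space (Suc n))
     {(\<lambda>j. \<Sum>i\<le>Suc n. a i * v i j) | a :: nat \<Rightarrow> real.
        (\<forall>i\<le>Suc n. 0 \<le> a i) \<and> (\<Sum>i\<le>Suc n. a i) = 1 \<and> (\<exists>i\<le>Suc n. a i = 0)}"

definition partition_of_unity ::
    "nat \<Rightarrow> 'a topology \<Rightarrow> (nat \<Rightarrow> 'a set) \<Rightarrow> (nat \<Rightarrow> 'a \<Rightarrow> real) \<Rightarrow> bool" where
  "partition_of_unity n X U \<phi> \<longleftrightarrow>
     (\<forall>i\<le>Suc n. continuous_map X euclideanreal (\<phi> i) \<and>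
        (\<forall>x \<in> topspace X. 0 \<le> \<phi> i x) \<and>
        X closure_of {x \<in> topspace X. \<phi> i x \<noteq> 0} \<subseteq> U i) \<and>
     (\<forall>x \<in> topspace X. (\<Sum>i\<le>Suc n. \<phi> i x) = 1)"

definition partition_map ::
    "nat \<Rightarrow> (nat \<Rightarrow> nat \<Rightarrow> real) \<Rightarrow> (nat \<Rightarrow> 'a \<Rightarrow> real) \<Rightarrow> 'a \<Rightarrow> nat \<Rightarrow> real" where
  "partition_map n v \<phi> x = (\<lambda>j. \<Sum>i\<le>Suc n. \<phi> i x * v i j)"

definition open_cover_class ::
    "nat \<Rightarrow> (nat \<Rightarrow> nat \<Rightarrow> real) \<Rightarrow> 'a topology \<Rightarrow> (nat \<Rightarrow> 'a set) \<Rightarrow> ('a \<Rightarrow> nat \<Rightarrow> real) set" where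
  "open_cover_class n v X U =
     {f. \<exists>\<phi>. partition_of_unity n X U \<phi> \<and>
             homotopic_with (\<lambda>_. True) X (sphere_top n v) (partition_map n v \<phi>) f}"

text \<open>
  The set of all maps in the homotopy class of the associated maps.  If the members of \<open>S\<close> are both
  open and closed, the two clauses describe the same class.
\<close>

definition cover_class ::
    "nat \<Rightarrow> (nat \<Rightarrow> nat \<Rightarrow> real) \<Rightarrow> 'a topology \<Rightarrow> (nat \<Rightarrow> 'a set) \<Rightarrow> ('a \<Rightarrow> nat \<Rightarrow> real) set" where
  "cover_class n v X S =
     {f. open_cover n X S \<and> f \<in> open_cover_class n v X S \<or>
         closed_cover n X S \<and>
           (\<exists>U. open_cover n X U \<and> (\<forall>i\<le>Suc n. S i \<subseteq> U i) \<and> (\<Inter>i\<le>Suc n. U i) = {} \<and>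
                f \<in> open_cover_class n v X U)}"


section \<open>Every cover of a normal space has an associated map\<close>

lemma shrink_open_cover:
  assumes X: "normal_space X" and U: "open_cover n X U"
  obtains V where "open_cover n X V" "\<And>i. i \<le> Suc n \<Longrightarrow> X closure_of V i \<subseteq> U i"
proof -
  have "\<exists>V. open_cover n X V \<and> (\<forall>i\<le>Suc n. i < k \<longrightarrow> X closure_of V i \<subseteq> U i) \<and>
            (\<forall>i\<le>Suc n. k \<le> i \<longrightarrow> V i = U i)" for k
  proof (induction k)
    case 0
    then show ?case using U by auto
  next
    case (Suc k)
    then obtain V where V: "open_cover n X V"
      and cl: "\<forall>i\<le>Suc n. i < k \<longrightarrow> X closure_of V i \<subseteq> U i"
      and eq: "\<forall>i\<le>Suc n. k \<le> i \<longrightarrow> V i = U i" by auto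
    show ?case
    proof (cases "k \<le> Suc n")
      case False
      then show ?thesis using V cl eq by (intro exI[of _ V]) auto
    next
      case True
      define A where "A = topspace X - (\<Union>i\<in>{..Suc n} - {k}. V i)"
      have "openin X (\<Union>i\<in>{..Suc n} - {k}. V i)"
        using V by (intro openin_Union) (auto simp: open_cover_def)
      then have A: "closedin X A" unfolding A_def by blast
      have "A \<subseteq> V k" using V True unfolding A_def open_cover_def by blast
      moreover have "openin X (V k)" using V True by (auto simp: open_cover_def)
      ultimately obtain T where T: "openin X T" "A \<subseteq> T" "X closure_of T \<subseteq> V k"
        using X A unfolding normal_space_alt by meson
      have sub: "T \<subseteq> V k"
        using T closure_of_subset[of T X] openin_subset by blast
      have "(\<Union>i\<le>Suc n. (V(k := T)) i) = topspace X"
      proof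
        show "(\<Union>i\<le>Suc n. (V(k := T)) i) \<subseteq> topspace X"
          using V T openin_subset by (fastforce simp: open_cover_def split: if_splits)
        show "topspace X \<subseteq> (\<Union>i\<le>Suc n. (V(k := T)) i)"
        proof
          fix x assume x: "x \<in> topspace X"
          show "x \<in> (\<Union>i\<le>Suc n. (V(k := T)) i)"
          proof (cases "x \<in> A")
            case True
            then show ?thesis using T \<open>k \<le> Suc n\<close> by auto
          next
            case False
            then obtain i where "i \<le> Suc n" "i \<noteq> k" "x \<in> V i" using x by (auto simp: A_def)
            then show ?thesis by auto
          qed
        qed
      qed
      then have "open_cover n X (V(k := T))" using V T by (auto simp: open_cover_def)
      moreover have "\<forall>i\<le>Suc n. i < Suc k \<longrightarrow> X closure_of (V(k := T)) i \<subseteq> U i"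
        using cl eq T True by (auto simp: less_Suc_eq)
      moreover have "\<forall>i\<le>Suc n. Suc k \<le> i \<longrightarrow> (V(k := T)) i = U i"
        using eq by auto
      ultimately show ?thesis by blast
    qed
  qed
  from this[of "Suc (Suc n)"] show ?thesis using that by auto
qed

lemma exists_partition_of_unity:
  assumes X: "normal_space X" and U: "open_cover n X U"
  obtains \<phi> where "partition_of_unity n X U \<phi>"
proof -
  obtain V where V: "open_cover n X V" "\<And>i. i \<le> Suc n \<Longrightarrow> X closure_of V i \<subseteq> U i"
    using shrink_open_cover[OF X U] by blast
  obtain T where T: "open_cover n X T" "\<And>i. i \<le> Suc n \<Longrightarrow> X closure_of T i \<subseteq> V i"
    using shrink_open_cover[OF X V(1)] by blast
  have "\<forall>i\<in>{..Suc n}. \<exists>g. continuous_map X (top_of_set {0..1::real}) g \<and>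
            g ` (topspace X - V i) \<subseteq> {0} \<and> g ` (X closure_of T i) \<subseteq> {1}"
  proof
    fix i assume "i \<in> {..Suc n}"
    then have "closedin X (topspace X - V i)" "closedin X (X closure_of T i)"
      "disjnt (topspace X - V i) (X closure_of T i)"
      using V(1) T(2)[of i] by (auto simp: open_cover_def disjnt_def)
    then obtain h where "continuous_map X (top_of_set {0..1::real}) h"
      "h ` (topspace X - V i) \<subseteq> {0}" "h ` (X closure_of T i) \<subseteq> {1}"
      by (rule Urysohn_lemma[OF X _ _ _ zero_le_one])
    then show "\<exists>g. continuous_map X (top_of_set {0..1::real}) g \<and>
        g ` (topspace X - V i) \<subseteq> {0} \<and> g ` (X closure_of T i) \<subseteq> {1}"
      by (intro exI[of _ h] conjI)
  qed
  from bchoice[OF this] obtain g where "\<forall>i\<in>{..Suc n}.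
      continuous_map X (top_of_set {0..1::real}) (g i) \<and>
      g i ` (topspace X - V i) \<subseteq> {0} \<and> g i ` (X closure_of T i) \<subseteq> {1}" ..
  then have g: "continuous_map X (top_of_set {0..1::real}) (g i)"
      "g i ` (topspace X - V i) \<subseteq> {0}" "g i ` (X closure_of T i) \<subseteq> {1}" if "i \<le> Suc n" for i
    using that by simp_all
  have cont: "continuous_map X euclideanreal (g i)" if "i \<le> Suc n" for i
    using g(1)[OF that] by (rule continuous_map_into_fulltopology)
  have nonneg: "0 \<le> g i x" if "i \<le> Suc n" "x \<in> topspace X" for i x
    using g(1)[OF that(1)] that(2) by (auto simp: continuous_map_in_subtopology Pi_iff)
  have pos: "0 < (\<Sum>i\<le>Suc n. g i x)" if x: "x \<in> topspace X" for x
  proof -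
    obtain k where k: "k \<le> Suc n" "x \<in> T k" using T(1) x by (auto simp: open_cover_def)
    moreover have "T k \<subseteq> X closure_of T k"
      using T(1) k(1) by (intro closure_of_subset openin_subset) (simp add: open_cover_def)
    ultimately have "x \<in> X closure_of T k" by blast
    then have "g k x = 1" using g(3)[OF k(1)] by blast
    then show ?thesis
      using nonneg x k by (intro sum_pos2[of _ k]) auto
  qed
  define \<phi> where "\<phi> i x = g i x / (\<Sum>i\<le>Suc n. g i x)" for i x
  have "partition_of_unity n X U \<phi>"
    unfolding partition_of_unity_def
  proof (intro conjI allI impI ballI)
    fix i assume i: "i \<le> Suc n"
    show "continuous_map X euclideanreal (\<phi> i)"
      unfolding \<phi>_def
    proof (intro continuous_map_real_divide continuous_map_sum)
      show "(\<Sum>i\<le>Suc n. g i x) \<noteq> 0" if "x \<in> topspace X" for x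
        using pos[OF that] by linarith
    qed (use cont i in auto)
    show "0 \<le> \<phi> i x" if "x \<in> topspace X" for x
      unfolding \<phi>_def using nonneg[OF i that] pos[OF that] by simp
    have "{x \<in> topspace X. \<phi> i x \<noteq> 0} \<subseteq> V i"
      using g(2)[OF i] by (fastforce simp: \<phi>_def)
    then show "X closure_of {x \<in> topspace X. \<phi> i x \<noteq> 0} \<subseteq> U i"
      using V(2)[OF i] closure_of_mono by blast
  next
    fix x assume "x \<in> topspace X"
    then show "(\<Sum>i\<le>Suc n. \<phi> i x) = 1"
      using pos[of x] by (simp add: \<phi>_def flip: sum_divide_distrib)
  qed
  then show ?thesis using that by blast
qed

lemma continuous_partition_map:
  assumes v: "simplex_vertices n v" and \<phi>: "partition_of_unity n X U \<phi>"
    and empty: "(\<Inter>i\<le>Suc n. U i) = {}"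
  shows "continuous_map X (sphere_top n v) (partition_map n v \<phi>)"
proof -
  have zero: "\<exists>i\<le>Suc n. \<phi> i x = 0" if x: "x \<in> topspace X" for x
  proof (rule ccontr)
    assume "\<not> ?thesis"
    then have "x \<in> X closure_of {x \<in> topspace X. \<phi> i x \<noteq> 0}" if "i \<le> Suc n" for i
      using x that closure_of_subset[of "{x \<in> topspace X. \<phi> i x \<noteq> 0}" X] by auto
    then have "x \<in> (\<Inter>i\<le>Suc n. U i)" using \<phi> by (auto simp: partition_of_unity_def)
    then show False using empty by simp
  qed
  have "continuous_map X (Euclidean_space (Suc n)) (partition_map n v \<phi>)"
    unfolding Euclidean_space_def continuous_map_in_subtopology
  proof
    show "continuous_map X (powertop_real UNIV) (partition_map n v \<phi>)"
      unfolding continuous_map_componentwise_UNIV partition_map_def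
      using \<phi> by (intro allI continuous_map_sum continuous_map_real_mult_right)
                 (auto simp: partition_of_unity_def)
    have "v i j = 0" if "i \<le> Suc n" "Suc n \<le> j" for i j
      using v that by (auto simp: simplex_vertices_def topspace_Euclidean_space)
    then show "partition_map n v \<phi> \<in> topspace X \<rightarrow> {x. \<forall>i\<ge>Suc n. x i = 0}"
      by (auto simp: partition_map_def)
  qed
  then show ?thesis
    unfolding sphere_top_def continuous_map_in_subtopology
  proof (intro conjI Pi_I CollectI)
    fix x assume x: "x \<in> topspace X"
    show "\<exists>a. partition_map n v \<phi> x = (\<lambda>j. \<Sum>i\<le>Suc n. a i * v i j) \<and>
        (\<forall>i\<le>Suc n. 0 \<le> a i) \<and> (\<Sum>i\<le>Suc n. a i) = 1 \<and> (\<exists>i\<le>Suc n. a i = 0)"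
      using \<phi> x zero[OF x]
      by (intro exI[of _ "\<lambda>i. \<phi> i x"]) (auto simp: partition_map_def partition_of_unity_def)
  qed
qed

lemma open_cover_class_nonempty:
  assumes "normal_space X" "simplex_vertices n v" "open_cover n X U" "(\<Inter>i\<le>Suc n. U i) = {}"
  shows "open_cover_class n v X U \<noteq> {}"
proof -
  obtain \<phi> where \<phi>: "partition_of_unity n X U \<phi>"
    using exists_partition_of_unity[OF assms(1,3)] by blast
  then have "partition_map n v \<phi> \<in> open_cover_class n v X U"
    using continuous_partition_map[OF assms(2) \<phi> assms(4)] by (auto simp: open_cover_class_def)
  then show ?thesis by blast
qed

lemma cover_class_nonempty:
  assumes X: "normal_space X" and v: "simplex_vertices n v"
    and S: "is_cover n X S" and empty: "(\<Inter>i\<le>Suc n. S i) = {}"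
  shows "cover_class n v X S \<noteq> {}"
proof (cases "open_cover n X S")
  case True
  then show ?thesis
    using open_cover_class_nonempty[OF X v True empty] by (auto simp: cover_class_def)
next
  case False
  then have cl: "closed_cover n X S" using S by (simp add: is_cover_def)
  have "open_cover n X (\<lambda>i. topspace X - S i)"
    using cl empty by (auto simp: open_cover_def closed_cover_def)
  then obtain V where V: "open_cover n X V"
    "\<And>i. i \<le> Suc n \<Longrightarrow> X closure_of V i \<subseteq> topspace X - S i"
    using shrink_open_cover[OF X] by metis
  define U where "U i = topspace X - X closure_of V i" for i
  have sub: "S i \<subseteq> U i" if "i \<le> Suc n" for i
    using V(2)[OF that] cl that closedin_subset[of X "S i"] by (auto simp: U_def closed_cover_def)
  have 1: "open_cover n X U"
    unfolding open_cover_def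
  proof
    show "\<forall>i\<le>Suc n. openin X (U i)" by (auto simp: U_def)
    show "(\<Union>i\<le>Suc n. U i) = topspace X"
    proof
      show "(\<Union>i\<le>Suc n. U i) \<subseteq> topspace X" by (auto simp: U_def)
      have "topspace X = (\<Union>i\<le>Suc n. S i)" using cl by (simp add: closed_cover_def)
      also have "\<dots> \<subseteq> (\<Union>i\<le>Suc n. U i)" using sub by (intro UN_mono) auto
      finally show "topspace X \<subseteq> (\<Union>i\<le>Suc n. U i)" .
    qed
  qed
  have "V i \<subseteq> X closure_of V i" if "i \<le> Suc n" for i
    using V(1) that by (intro closure_of_subset openin_subset) (simp add: open_cover_def)
  then have "(\<Union>i\<le>Suc n. V i) \<subseteq> (\<Union>i\<le>Suc n. X closure_of V i)"
    by (intro UN_mono) auto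
  then have "topspace X \<subseteq> (\<Union>i\<le>Suc n. X closure_of V i)"
    using V(1) by (simp add: open_cover_def)
  then have 2: "(\<Inter>i\<le>Suc n. U i) = {}" unfolding U_def by blast
  show ?thesis
    using open_cover_class_nonempty[OF X v 1 2] cl 1 2 sub unfolding cover_class_def by blast
qed

end

theory Submission
  imports Defs
begin

text \<open>
  Both kinds of cobordism ask for the same thing: that data given on the boundary of some cobordism
  \<open>W\<close> extend over \<open>W\<close>.  So it suffices to fix \<open>W\<close>, a compact metrizable space in which the two
  manifolds sit as disjoint closed sets (\<open>cobordism_closed_embeddings\<close>), and to show that the covers
  extend to a cover of \<open>W\<close> with empty intersection if and only if the maps extend to \<open>W\<close>.

  From covers to maps (\<open>extended_cover_imp_extended_map\<close>): a map associated with the extended cover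
  restricts on each manifold to a map associated with the given cover, hence to one homotopic to the
  given map, because a cover determines a single homotopy class (\<open>cover_class_homotopic\<close>).  The
  homotopy is absorbed by the homotopy extension property for closed subsets and maps to the sphere
  (\<open>homotopy_extension_sphere\<close>), which rests on Tietze's theorem and on a retraction of a
  neighbourhood of the boundary of the simplex.

  From maps to covers (\<open>extended_map_imp_extended_cover\<close>): by homotopy extension the map on \<open>W\<close> may
  be taken to restrict to associated maps on the boundary.  Let \<open>a k\<close> be its barycentric coordinates.
  The sets where \<open>a k\<close> exceeds a small \<open>\<epsilon>\<close> cover \<open>W\<close>, and as one coordinate vanishes at each point
  they have no common point; but on the boundary they only lie inside the given sets, or inside
  neighbourhoods of them.  The given cover itself is extended separately: a closed cover by zero sets
  of functions \<open>g k \<ge> 0\<close> extends to the cover by the sets on which \<open>g k\<close> is the least of the functions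
  (\<open>extend_closed_cover\<close>), and an open cover is treated through complements.  This extension is used
  near the boundary and the coordinates of the map away from it; where the two meet, the
  intersection stays empty because it is already empty on the boundary and \<open>W\<close> is normal
  (\<open>extend_closed_cover_along_map\<close>, \<open>extend_open_cover_along_map\<close>).  Zero sets and minima thus do
  the work that a collar of the boundary would do in the smooth setting.
\<close>

section \<open>Closed sets as zero sets\<close>

lemma closedin_le_continuous_map:
  assumes "continuous_map X euclideanreal f" "continuous_map X euclideanreal g"
  shows "closedin X {x \<in> topspace X. f x \<le> g x}"
proof -
  have "closedin X {x \<in> topspace X. g x - f x \<in> {0..}}"
    using assms by (intro closedin_continuous_map_preimage[where Y = euclideanreal] continuous_map_diff) auto
  then show ?thesis by simp
qed

lemma openin_less_continuous_map:
  assumes "continuous_map X euclideanreal f" "continuous_map X euclideanreal g"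
  shows "openin X {x \<in> topspace X. f x < g x}"
proof -
  have "openin X {x \<in> topspace X. g x - f x \<in> {0<..}}"
    using assms by (intro openin_continuous_map_preimage[where Y = euclideanreal] continuous_map_diff) auto
  then show ?thesis by simp
qed

text \<open>
  The function is a series of Urysohn functions vanishing on \<open>D\<close>, one for each basic open set with
  closure disjoint from \<open>D\<close>; by regularity such sets fill the complement of \<open>D\<close>.
\<close>

lemma closedin_imp_zero_set:
  assumes X: "normal_space X" "regular_space X" "second_countable X" and D: "closedin X D"
  obtains g where "continuous_map X euclideanreal g" "\<And>x. x \<in> topspace X \<Longrightarrow> 0 \<le> g x"
    "\<And>x. x \<in> topspace X \<Longrightarrow> g x = (0::real) \<longleftrightarrow> x \<in> D"
proof -
  obtain B where B: "countable B" "\<And>V. V \<in> B \<Longrightarrow> openin X V"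
    and base: "\<And>U x. openin X U \<Longrightarrow> x \<in> U \<Longrightarrow> \<exists>V\<in>B. x \<in> V \<and> V \<subseteq> U"
    using X(3) unfolding second_countable_def by metis
  \<comment> \<open>The empty set is added so that the family can be enumerated by all natural numbers.\<close>
  define C where "C = insert {} {V \<in> B. disjnt D (X closure_of V)}"
  have "countable C" "C \<noteq> {}" using B(1) by (auto simp: C_def)
  then obtain V :: "nat \<Rightarrow> _" where V: "range V = C"
    using uncountable_def by blast
  have "\<exists>h. continuous_map X (top_of_set {0..1::real}) h \<and> h ` D \<subseteq> {0} \<and>
            h ` (X closure_of V k) \<subseteq> {1}" for k
  proof -
    have "V k \<in> C" using V by blast
    then have "disjnt D (X closure_of V k)" by (auto simp: C_def)
    from Urysohn_lemma[OF X(1) D closedin_closure_of this zero_le_one] show ?thesis by metis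
  qed
  then obtain h where h: "\<And>k. continuous_map X (top_of_set {0..1::real}) (h k)"
    "\<And>k. h k ` D \<subseteq> {0}" "\<And>k. h k ` (X closure_of V k) \<subseteq> {1}" by metis
  have hc: "continuous_map X euclideanreal (h k)" for k
    using h(1) by (rule continuous_map_into_fulltopology)
  have h01: "0 \<le> h k x \<and> h k x \<le> 1" if "x \<in> topspace X" for k x
    using h(1)[of k] that by (auto simp: continuous_map_in_subtopology Pi_iff)
  define g where "g x = (\<Sum>k. h k x * (1/2)^k)" for x
  have bound: "norm (h k x * (1/2)^k) \<le> (1/2)^k" if "x \<in> topspace X" for k x
    using h01[OF that, of k] by (simp add: mult_left_le_one_le)
  have summ: "summable (\<lambda>k. h k x * (1/2)^k)" if "x \<in> topspace X" for x
    by (rule summable_comparison_test'[OF summable_geometric bound[OF that]]) auto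
  have unif: "uniform_limit (topspace X) (\<lambda>n x. \<Sum>k<n. h k x * (1/2)^k) g sequentially"
    unfolding g_def by (rule Weierstrass_m_test[OF bound]) (auto intro: summable_geometric)
  have "continuous_map X Met_TC.mtopology g"
  proof (rule Met_TC.continuous_map_uniform_limit)
    show "\<forall>\<^sub>F n in sequentially. continuous_map X Met_TC.mtopology (\<lambda>x. \<Sum>k<n. h k x * (1/2)^k)"
      using hc by (intro always_eventually allI)
        (auto intro!: continuous_map_sum continuous_map_real_mult_right)
    show "\<forall>\<^sub>F n in sequentially. \<forall>x\<in>topspace X. g x \<in> UNIV \<and>
        dist (\<Sum>k<n. h k x * (1/2)^k) (g x) < \<epsilon>" if "0 < \<epsilon>" for \<epsilon>
      using unif that by (auto simp: uniform_limit_iff)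
  qed auto
  then have "continuous_map X euclideanreal g" by simp
  moreover have "0 \<le> g x" if "x \<in> topspace X" for x
    unfolding g_def using h01[OF that] by (intro suminf_nonneg summ[OF that]) auto
  moreover have "g x = 0 \<longleftrightarrow> x \<in> D" if x: "x \<in> topspace X" for x
  proof
    assume "x \<in> D"
    then have "h k x = 0" for k using h(2) by blast
    then show "g x = 0" by (simp add: g_def)
  next
    assume g0: "g x = 0"
    show "x \<in> D"
    proof (rule ccontr)
      assume "x \<notin> D"
      then obtain U where U: "openin X U" "x \<in> U" "disjnt D (X closure_of U)"
        using X(2) D x unfolding regular_space by blast
      then obtain V' where V': "V' \<in> B" "x \<in> V'" "V' \<subseteq> U" using base by blast
      then have "V' \<in> C"
        using U(3) closure_of_mono[OF V'(3), of X] by (auto simp: C_def disjnt_def)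
      then obtain k where k: "V' = V k" using V by blast
      have "V' \<subseteq> X closure_of V'"
        using B(2)[OF V'(1)] by (intro closure_of_subset openin_subset)
      then have "h k x = 1" using h(3)[of k] V'(2) k by blast
      moreover have "h k x * (1/2)^k = 0"
        using g0 suminf_eq_zero_iff[OF summ[OF x]] h01[OF x] by (simp add: g_def)
      ultimately show False by simp
    qed
  qed
  ultimately show ?thesis using that by blast
qed

section \<open>The boundary of the simplex in barycentric coordinates\<close>

text \<open>
  Coordinates beyond \<open>n + 1\<close> are set to 0 so that a point of the simplex has only one representative.
\<close>

definition simplex_boundary :: "nat \<Rightarrow> (nat \<Rightarrow> real) topology" where
  "simplex_boundary n = subtopology (powertop_real UNIV)
     {a. (\<forall>i\<le>Suc n. 0 \<le> a i) \<and> (\<forall>i>Suc n. a i = 0) \<and> (\<Sum>i\<le>Suc n. a i) = 1 \<and>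
         (\<exists>i\<le>Suc n. a i = 0)}"

definition simplex_point :: "nat \<Rightarrow> (nat \<Rightarrow> nat \<Rightarrow> real) \<Rightarrow> (nat \<Rightarrow> real) \<Rightarrow> nat \<Rightarrow> real" where
  "simplex_point n v a = (\<lambda>j. \<Sum>i\<le>Suc n. a i * v i j)"

lemma topspace_simplex_boundary:
  "topspace (simplex_boundary n) =
     {a. (\<forall>i\<le>Suc n. 0 \<le> a i) \<and> (\<forall>i>Suc n. a i = 0) \<and> (\<Sum>i\<le>Suc n. a i) = 1 \<and>
         (\<exists>i\<le>Suc n. a i = 0)}"
  by (simp add: simplex_boundary_def)

lemma continuous_map_simplex_boundary:
  "continuous_map X (simplex_boundary n) f \<longleftrightarrow>
     (\<forall>i. continuous_map X euclideanreal (\<lambda>x. f x i)) \<and>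
     (\<forall>x\<in>topspace X. f x \<in> topspace (simplex_boundary n))"
  unfolding simplex_boundary_def continuous_map_in_subtopology continuous_map_componentwise_UNIV
  by auto

lemma simplex_boundary_coordinate_le_1:
  assumes "a \<in> topspace (simplex_boundary n)"
  shows "a i \<le> 1"
proof (cases "i \<le> Suc n")
  case True
  then have "a i \<le> (\<Sum>i\<le>Suc n. a i)"
    using assms by (intro member_le_sum) (auto simp: topspace_simplex_boundary)
  then show ?thesis using assms by (simp add: topspace_simplex_boundary)
qed (use assms in \<open>auto simp: topspace_simplex_boundary\<close>)

lemma compact_space_simplex_boundary: "compact_space (simplex_boundary n)"
proof -
  let ?R = "powertop_real (UNIV :: nat set)"
  have coord: "continuous_map ?R euclideanreal (\<lambda>a. a i)" for i
    by (rule continuous_map_product_projection) auto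
  have sum: "continuous_map ?R euclideanreal (\<lambda>a. \<Sum>i\<le>Suc n. a i)"
    using coord by (intro continuous_map_sum) auto
  have eq: "topspace (simplex_boundary n) =
      (\<Inter>i\<in>{..Suc n}. {a \<in> topspace ?R. 0 \<le> a i}) \<inter>
      (\<Inter>i\<in>{Suc n<..}. {a \<in> topspace ?R. a i \<in> {0}}) \<inter>
      {a \<in> topspace ?R. (\<Sum>i\<le>Suc n. a i) \<in> {1}} \<inter>
      (\<Union>i\<in>{..Suc n}. {a \<in> topspace ?R. a i \<in> {0}})"
    unfolding topspace_simplex_boundary by (auto simp del: sum.atMost_Suc)
  have nonneg: "closedin ?R {a \<in> topspace ?R. 0 \<le> a i}" for i
    by (rule closedin_le_continuous_map[OF _ coord]) simp
  have level: "closedin ?R {a \<in> topspace ?R. f a \<in> {c}}"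
    if "continuous_map ?R euclideanreal f" for f c
    by (rule closedin_continuous_map_preimage[OF that]) simp
  have "closedin ?R (\<Union>i\<in>{..Suc n}. {a \<in> topspace ?R. a i \<in> {0}})"
    by (rule closedin_Union) (use level[OF coord] in blast)+
  then have "closedin ?R (topspace (simplex_boundary n))"
    unfolding eq
    by (intro closedin_Int closedin_INT nonneg level[OF coord] level[OF sum]) auto
  moreover have "compactin ?R (PiE UNIV (\<lambda>_. {0..1}))"
    by (simp add: compactin_PiE)
  moreover have "topspace (simplex_boundary n) \<subseteq> PiE UNIV (\<lambda>_. {0..1})"
  proof (intro subsetI PiE_I)
    fix a :: "nat \<Rightarrow> real" and i assume a: "a \<in> topspace (simplex_boundary n)"
    then have "0 \<le> a i" by (cases "i \<le> Suc n") (auto simp: topspace_simplex_boundary)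
    then show "a i \<in> {0..1}" using simplex_boundary_coordinate_le_1[OF a] by simp
  qed simp
  ultimately have "compactin ?R (topspace (simplex_boundary n))"
    using closed_compactin by blast
  then show ?thesis
    by (simp add: simplex_boundary_def compact_space_subtopology)
qed

text \<open>
  Affine independence makes the map injective, and a continuous bijection from a compact space
  onto a Hausdorff space has a continuous inverse.
\<close>

lemma homeomorphic_map_simplex_point:
  assumes v: "simplex_vertices n v"
  shows "homeomorphic_map (simplex_boundary n) (sphere_top n v) (simplex_point n v)"
proof (rule continuous_imp_homeomorphic_map)
  have v0: "v i j = 0" if "i \<le> Suc n" "Suc n \<le> j" for i j
    using v that by (auto simp: simplex_vertices_def topspace_Euclidean_space)
  have img: "simplex_point n v ` topspace (simplex_boundary n) =
      {(\<lambda>j. \<Sum>i\<le>Suc n. a i * v i j) | a :: nat \<Rightarrow> real.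
        (\<forall>i\<le>Suc n. 0 \<le> a i) \<and> (\<Sum>i\<le>Suc n. a i) = 1 \<and> (\<exists>i\<le>Suc n. a i = 0)}" (is "?L = ?R")
  proof
    show "?R \<subseteq> ?L"
    proof clarify
      fix a :: "nat \<Rightarrow> real" and k
      assume a: "\<forall>i\<le>Suc n. 0 \<le> a i" "(\<Sum>i\<le>Suc n. a i) = 1" "k \<le> Suc n" "a k = 0"
      let ?b = "\<lambda>i. if i \<le> Suc n then a i else 0"
      have "?b \<in> topspace (simplex_boundary n)"
        using a by (auto simp: topspace_simplex_boundary intro!: exI[of _ k])
      moreover have "simplex_point n v ?b = (\<lambda>j. \<Sum>i\<le>Suc n. a i * v i j)"
        unfolding simplex_point_def by (intro ext sum.cong) auto
      ultimately show "(\<lambda>j. \<Sum>i\<le>Suc n. a i * v i j) \<in> ?L" by (metis imageI)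
    qed
  qed (auto simp: topspace_simplex_boundary simplex_point_def)
  have sub: "?L \<subseteq> topspace (Euclidean_space (Suc n))"
    by (auto simp: simplex_point_def topspace_Euclidean_space v0 simp del: sum.atMost_Suc)
  show "simplex_point n v ` topspace (simplex_boundary n) = topspace (sphere_top n v)"
    using Int_absorb1[OF sub[unfolded img]] img by (simp only: sphere_top_def topspace_subtopology)
  have coord: "continuous_map (simplex_boundary n) euclideanreal (\<lambda>a. a i)" for i
    using continuous_map_simplex_boundary[of "simplex_boundary n" n "\<lambda>a. a"]
    by (simp add: continuous_map_id[unfolded id_def])
  show "continuous_map (simplex_boundary n) (sphere_top n v) (simplex_point n v)"
    unfolding sphere_top_def Euclidean_space_def subtopology_subtopology continuous_map_in_subtopology
      continuous_map_componentwise_UNIV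
  proof (intro conjI allI)
    show "continuous_map (simplex_boundary n) euclideanreal (\<lambda>a. simplex_point n v a j)" for j
      unfolding simplex_point_def using coord
      by (intro continuous_map_sum continuous_map_real_mult_right) auto
    show "simplex_point n v \<in> topspace (simplex_boundary n) \<rightarrow> {x. \<forall>i\<ge>Suc n. x i = 0} \<inter>
      {(\<lambda>j. \<Sum>i\<le>Suc n. a i * v i j) | a :: nat \<Rightarrow> real.
        (\<forall>i\<le>Suc n. 0 \<le> a i) \<and> (\<Sum>i\<le>Suc n. a i) = 1 \<and> (\<exists>i\<le>Suc n. a i = 0)}"
      unfolding img[symmetric]
      by (auto simp: simplex_point_def v0 simp del: sum.atMost_Suc)
  qed
  show "compact_space (simplex_boundary n)" by (rule compact_space_simplex_boundary)
  show "Hausdorff_space (sphere_top n v)"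
    unfolding sphere_top_def by (intro Hausdorff_space_subtopology Hausdorff_Euclidean_space)
  show "inj_on (simplex_point n v) (topspace (simplex_boundary n))"
  proof (rule inj_onI)
    fix a b
    assume a: "a \<in> topspace (simplex_boundary n)" and b: "b \<in> topspace (simplex_boundary n)"
      and eq: "simplex_point n v a = simplex_point n v b"
    have "(\<Sum>i\<le>Suc n. (a i - b i) * v i j) = 0" for j
      using fun_cong[OF eq, of j] by (simp add: simplex_point_def algebra_simps sum_subtractf)
    moreover have "(\<Sum>i\<le>Suc n. a i - b i) = 0"
      using a b by (simp add: topspace_simplex_boundary sum_subtractf)
    ultimately have "\<forall>i\<le>Suc n. a i - b i = 0"
      using v unfolding simplex_vertices_def by (elim conjE allE[of _ "\<lambda>i. a i - b i"]) blast
    then have "a i = b i" for i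
      using a b by (cases "i \<le> Suc n") (auto simp: topspace_simplex_boundary simp del: sum.atMost_Suc)
    then show "a = b" ..
  qed
qed

text \<open>
  Off the line where all coordinates agree, subtracting the minimum and rescaling retracts onto
  the boundary of the simplex; points of the boundary stay fixed, since their least coordinate is 0
  and their sum is 1.
\<close>

definition simplex_retraction :: "nat \<Rightarrow> (nat \<Rightarrow> real) \<Rightarrow> nat \<Rightarrow> real" where
  "simplex_retraction n a =
     (let m = Min (a ` {..Suc n})
      in (\<lambda>i. if i \<le> Suc n then (a i - m) / (\<Sum>j\<le>Suc n. a j - m) else 0))"

lemma simplex_boundary_not_constant:
  assumes "a \<in> topspace (simplex_boundary n)"
  shows "\<exists>i\<le>Suc n. \<exists>j\<le>Suc n. a i \<noteq> a j"
proof (rule ccontr)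
  assume "\<not> ?thesis"
  moreover obtain k where "k \<le> Suc n" "a k = 0"
    using assms by (auto simp: topspace_simplex_boundary)
  ultimately have "a i = 0" if "i \<le> Suc n" for i using that by metis
  then have "(\<Sum>i\<le>Suc n. a i) = 0" by (intro sum.neutral) auto
  then show False using assms by (simp add: topspace_simplex_boundary)
qed

lemma sum_above_Min_pos:
  fixes a :: "nat \<Rightarrow> real"
  assumes "\<exists>i\<le>N. \<exists>j\<le>N. a i \<noteq> a j"
  shows "0 < (\<Sum>j\<le>N. a j - Min (a ` {..N}))"
proof -
  have le: "Min (a ` {..N}) \<le> a j" if "j \<le> N" for j using that by simp
  obtain i j where "i \<le> N" "j \<le> N" "a i \<noteq> a j" using assms by blast
  then obtain k where "k \<le> N" "Min (a ` {..N}) < a k"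
    using le by (metis order_le_less)
  then show ?thesis using le by (intro sum_pos2[of _ k]) auto
qed

lemma simplex_retraction_eq:
  assumes "a \<in> topspace (simplex_boundary n)"
  shows "simplex_retraction n a = a"
proof -
  have "Min (a ` {..Suc n}) = 0"
    using assms by (intro Min_eqI) (auto simp: topspace_simplex_boundary simp del: sum.atMost_Suc)
  then show ?thesis
    using assms unfolding simplex_retraction_def
    by (auto simp: topspace_simplex_boundary simp del: sum.atMost_Suc)
qed

lemma simplex_retraction_in_boundary:
  assumes "\<exists>i\<le>Suc n. \<exists>j\<le>Suc n. a i \<noteq> a j"
  shows "simplex_retraction n a \<in> topspace (simplex_boundary n)"
proof -
  let ?m = "Min (a ` {..Suc n})"
  let ?s = "\<Sum>j\<le>Suc n. a j - ?m"
  have s: "0 < ?s" using sum_above_Min_pos[OF assms] .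
  have "?m \<in> a ` {..Suc n}" by (intro Min_in) auto
  then obtain k where "k \<le> Suc n" "a k = ?m" by (metis atMost_iff imageE)
  moreover have "(\<Sum>i\<le>Suc n. (a i - ?m) / ?s) = 1"
    using s by (simp flip: sum_divide_distrib)
  moreover have "0 \<le> (a i - ?m) / ?s" if "i \<le> Suc n" for i
    using s that by (intro divide_nonneg_pos) auto
  moreover have "(a k - ?m) / ?s = 0" using \<open>a k = ?m\<close> by simp
  moreover have "simplex_retraction n a i = (if i \<le> Suc n then (a i - ?m) / ?s else 0)" for i
    by (simp add: simplex_retraction_def Let_def)
  ultimately show ?thesis
    unfolding topspace_simplex_boundary
    by (simp del: sum.atMost_Suc cong: sum.cong_simp) blast
qed

lemma continuous_map_Min:
  fixes g :: "'a \<Rightarrow> nat \<Rightarrow> real"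
  assumes "\<And>i. continuous_map X euclideanreal (\<lambda>x. g x i)"
  shows "continuous_map X euclideanreal (\<lambda>x. Min (g x ` {..N}))"
proof (induction N)
  case (Suc N)
  have "Min (g x ` {..Suc N}) = min (g x (Suc N)) (Min (g x ` {..N}))" for x
    by (simp add: atMost_Suc)
  then show ?case using Suc assms by (simp add: continuous_map_real_min)
qed (simp add: assms)

lemma continuous_map_simplex_retraction:
  assumes g: "\<And>i. continuous_map X euclideanreal (\<lambda>x. g x i)"
    and nc: "\<And>x. x \<in> topspace X \<Longrightarrow> \<exists>i\<le>Suc n. \<exists>j\<le>Suc n. g x i \<noteq> g x j"
  shows "continuous_map X (simplex_boundary n) (\<lambda>x. simplex_retraction n (g x))"
  unfolding continuous_map_simplex_boundary
proof (intro conjI allI ballI)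
  show "simplex_retraction n (g x) \<in> topspace (simplex_boundary n)" if "x \<in> topspace X" for x
    by (rule simplex_retraction_in_boundary[OF nc[OF that]])
  fix i
  let ?m = "\<lambda>x. Min (g x ` {..Suc n})"
  have m: "continuous_map X euclideanreal ?m" by (rule continuous_map_Min[OF g])
  show "continuous_map X euclideanreal (\<lambda>x. simplex_retraction n (g x) i)"
  proof (cases "i \<le> Suc n")
    case True
    have "continuous_map X euclideanreal (\<lambda>x. (g x i - ?m x) / (\<Sum>j\<le>Suc n. g x j - ?m x))"
    proof (intro continuous_map_real_divide continuous_map_diff continuous_map_sum g m)
      show "(\<Sum>j\<le>Suc n. g x j - ?m x) \<noteq> 0" if "x \<in> topspace X" for x
        using sum_above_Min_pos[OF nc[OF that]] by linarith
    qed auto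
    then show ?thesis using True by (simp add: simplex_retraction_def Let_def del: sum.atMost_Suc)
  qed (simp add: simplex_retraction_def Let_def)
qed

section \<open>Homotopy extension\<close>

text \<open>
  A homotopy on \<open>e ` X\<close> that starts at \<open>F\<close> is extended coordinate by coordinate, by Tietze's theorem,
  to the cylinder over \<open>W\<close>.  The extension leaves the boundary of the simplex, but its values near
  the closed set can be retracted back.  Away from there the time is slowed down to 0 by a Urysohn
  function, which also allows \<open>F\<close> to be left unchanged on a given disjoint closed set \<open>B\<close>.
\<close>

lemma homotopy_extension_simplex_boundary:
  fixes F :: "'b \<Rightarrow> nat \<Rightarrow> real" and e :: "'a \<Rightarrow> 'b"
  assumes W: "compact_space W" "Hausdorff_space W"
    and e: "embedding_map X W e" and A: "closedin W (e ` topspace X)"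
    and B: "closedin W B" "disjnt (e ` topspace X) B"
    and F: "continuous_map W (simplex_boundary n) F"
    and hom: "homotopic_with (\<lambda>_. True) X (simplex_boundary n) (F \<circ> e) h"
  obtains G where "continuous_map W (simplex_boundary n) G"
    "\<And>x. x \<in> topspace X \<Longrightarrow> G (e x) = h x" "\<And>w. w \<in> B \<Longrightarrow> G w = F w"
proof -
  let ?I = "top_of_set {0..1::real}"
  define A where "A = e ` topspace X"
  have AW: "A \<subseteq> topspace W" using A closedin_subset by (auto simp: A_def)
  obtain e' where e': "continuous_map (subtopology W A) X e'"
    "\<And>x. x \<in> topspace X \<Longrightarrow> e' (e x) = x"
    using e unfolding embedding_map_def homeomorphic_map_maps homeomorphic_maps_def A_def by blast
  obtain k where k: "continuous_map (prod_topology ?I X) (simplex_boundary n) k"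
    "\<And>x. k (0, x) = F (e x)" "\<And>x. k (1, x) = h x"
    using hom by (auto simp: homotopic_with_def)
  have IW: "compact_space (prod_topology ?I W)" "Hausdorff_space (prod_topology ?I W)"
    using W by (auto simp: compact_space_prod_topology compact_space_subtopology
        Hausdorff_space_prod_topology Hausdorff_space_subtopology)
  have nW: "normal_space W" "normal_space (prod_topology ?I W)"
    using W IW by (auto intro: compact_Hausdorff_or_regular_imp_normal_space)
  have clIA: "closedin (prod_topology ?I W) ({0..1} \<times> A)"
    using A by (auto simp: closedin_prod_Times_iff A_def)
  have "continuous_map (prod_topology ?I (subtopology W A)) (prod_topology ?I X) (\<lambda>z. (fst z, e' (snd z)))"
    using e'(1) by (intro continuous_map_pairedI continuous_map_fst
        continuous_map_compose[OF continuous_map_snd, unfolded o_def]) auto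
  from continuous_map_compose[OF this k(1)]
  have kc: "continuous_map (subtopology (prod_topology ?I W) ({0..1} \<times> A)) (simplex_boundary n)
      (\<lambda>z. k (fst z, e' (snd z)))"
    by (simp add: o_def prod_topology_subtopology subtopology_subtopology)
  have "\<exists>K. continuous_map (prod_topology ?I W) euclideanreal K \<and>
      (\<forall>z\<in>{0..1} \<times> A. K z = k (fst z, e' (snd z)) i)" for i
  proof -
    have "continuous_map (subtopology (prod_topology ?I W) ({0..1} \<times> A)) euclideanreal
        (\<lambda>z. k (fst z, e' (snd z)) i)"
      using kc by (simp add: continuous_map_simplex_boundary)
    from Tietze_extension_realinterval[OF nW(2) clIA is_interval_univ UNIV_not_empty this subset_UNIV]
    show ?thesis by metis
  qed
  then obtain K where K: "\<And>i. continuous_map (prod_topology ?I W) euclideanreal (K i)"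
    "\<And>i t x. t \<in> {0..1} \<Longrightarrow> x \<in> topspace X \<Longrightarrow> K i (t, e x) = k (t, x) i"
    using e'(2) by (metis (no_types, lifting) A_def SigmaI fst_conv imageI snd_conv)
  \<comment> \<open>The correction makes the value at time 0 equal to \<open>F\<close> also off \<open>A\<close>.\<close>
  define g where "g t w i = F w i + K i (t, w) - K i (0, w)" for t w i
  have g0: "g 0 w = F w" for w by (auto simp: g_def)
  have gA: "g t (e x) = k (t, x)" if "t \<in> {0..1}" "x \<in> topspace X" for t x
    using that K(2) k(2) by (auto simp: g_def)
  have Fi: "continuous_map W euclideanreal (\<lambda>w. F w i)" for i
    using F by (simp add: continuous_map_simplex_boundary)
  have gc: "continuous_map Z euclideanreal (\<lambda>z. g (p z) (q z) i)"
    if "continuous_map Z ?I p" "continuous_map Z W q" for Z :: "'c topology" and p q i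
  proof -
    have "continuous_map Z (prod_topology ?I W) (\<lambda>z. (p z, q z))"
      "continuous_map Z (prod_topology ?I W) (\<lambda>z. (0, q z))"
      using that by (auto intro: continuous_map_pairedI)
    from this[THEN continuous_map_compose[OF _ K(1)[of i]]]
    show ?thesis
      using continuous_map_compose[OF that(2) Fi[of i]] unfolding g_def o_def
      by (intro continuous_map_diff continuous_map_add)
  qed
  define N where "N = {z \<in> topspace (prod_topology ?I W).
      \<forall>i\<in>{..Suc n}. \<forall>j\<in>{..Suc n}. g (fst z) (snd z) i \<le> g (fst z) (snd z) j}"
  have Neq: "N = (\<Inter>i\<in>{..Suc n}. \<Inter>j\<in>{..Suc n}. {z \<in> topspace (prod_topology ?I W).
      g (fst z) (snd z) i \<le> g (fst z) (snd z) j})"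
    by (auto simp: N_def simp del: topspace_prod_topology)
  have "continuous_map (prod_topology ?I W) euclideanreal (\<lambda>z. g (fst z) (snd z) i)" for i
    by (rule gc[OF continuous_map_fst continuous_map_snd])
  then have "closedin (prod_topology ?I W) N"
    unfolding Neq by (intro closedin_INT closedin_le_continuous_map) auto
  then have clN: "closedin W (snd ` N)"
    using closed_map_snd[of ?I W] by (simp add: closed_map_def compact_space_subtopology)
  have "disjnt A (snd ` N)"
  proof (clarsimp simp: disjnt_iff A_def)
    fix x t assume x: "x \<in> topspace X" and "(t, e x) \<in> N"
    then have t: "t \<in> {0..1}" and le: "\<forall>i\<le>Suc n. \<forall>j\<le>Suc n. k (t, x) i \<le> k (t, x) j"
      by (auto simp: N_def gA)
    have "k (t, x) \<in> topspace (simplex_boundary n)"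
      using k(1) t x by (auto simp: continuous_map_def Pi_iff)
    then show False using simplex_boundary_not_constant le by (meson order_antisym)
  qed
  then have "disjnt (snd ` N \<union> B) A" using B(2) by (auto simp: disjnt_iff A_def)
  then obtain u where u: "continuous_map W ?I u" "u ` (snd ` N \<union> B) \<subseteq> {0}" "u ` A \<subseteq> {1}"
    using Urysohn_lemma[OF nW(1) closedin_Un[OF clN B(1)] A[folded A_def] _ zero_le_one] by blast
  define G where "G w = simplex_retraction n (g (u w) w)" for w
  have u01: "u w \<in> {0..1}" if "w \<in> topspace W" for w
    using u(1) that by (auto simp: continuous_map_in_subtopology Pi_iff)
  show thesis
  proof (rule that)
    show "continuous_map W (simplex_boundary n) G"
      unfolding G_def
    proof (rule continuous_map_simplex_retraction)
      show "continuous_map W euclideanreal (\<lambda>w. g (u w) w i)" for i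
        by (rule gc[OF u(1) continuous_map_id[unfolded id_def]])
      fix w assume w: "w \<in> topspace W"
      show "\<exists>i\<le>Suc n. \<exists>j\<le>Suc n. g (u w) w i \<noteq> g (u w) w j"
      proof (cases "w \<in> snd ` N")
        case True
        then have "u w = 0" using u(2) by blast
        then show ?thesis
          using simplex_boundary_not_constant[of "F w" n] F w
          by (auto simp: g0 continuous_map_def Pi_iff)
      next
        case False
        then have "(u w, w) \<notin> N" by force
        then show ?thesis using w u01[OF w] by (auto simp: N_def not_le) (metis less_irrefl)
      qed
    qed
    show "G (e x) = h x" if "x \<in> topspace X" for x
    proof -
      have "u (e x) = 1" using that u(3) by (auto simp: A_def)
      moreover have "k (1, x) \<in> topspace (simplex_boundary n)"
        using k(1) that by (auto simp: continuous_map_def Pi_iff)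
      ultimately show ?thesis
        using that by (simp add: G_def gA simplex_retraction_eq flip: k(3))
    qed
    show "G w = F w" if "w \<in> B" for w
    proof -
      have "u w = 0" using that u(2) by blast
      moreover have "F w \<in> topspace (simplex_boundary n)"
        using F that closedin_subset[OF B(1)] by (auto simp: continuous_map_def Pi_iff)
      ultimately show ?thesis by (simp add: G_def g0 simplex_retraction_eq)
    qed
  qed
qed

text \<open>The two sets are treated in turn; each step leaves the map unchanged on the other set.\<close>

lemma homotopy_extension_two:
  assumes W: "compact_space W" "Hausdorff_space W"
    and e1: "embedding_map X1 W e1" "closedin W (e1 ` topspace X1)"
    and e2: "embedding_map X2 W e2" "closedin W (e2 ` topspace X2)"
    and disj: "disjnt (e1 ` topspace X1) (e2 ` topspace X2)"
    and F: "continuous_map W (simplex_boundary n) F"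
    and hom1: "homotopic_with (\<lambda>_. True) X1 (simplex_boundary n) (F \<circ> e1) h1"
    and hom2: "homotopic_with (\<lambda>_. True) X2 (simplex_boundary n) (F \<circ> e2) h2"
  obtains G where "continuous_map W (simplex_boundary n) G"
    "\<And>x. x \<in> topspace X1 \<Longrightarrow> G (e1 x) = h1 x" "\<And>x. x \<in> topspace X2 \<Longrightarrow> G (e2 x) = h2 x"
proof -
  obtain H where H: "continuous_map W (simplex_boundary n) H"
    "\<And>x. x \<in> topspace X1 \<Longrightarrow> H (e1 x) = h1 x"
    "\<And>w. w \<in> e2 ` topspace X2 \<Longrightarrow> H w = F w"
    using homotopy_extension_simplex_boundary[OF W e1 e2(2) disj F hom1] by blast
  have e2c: "continuous_map X2 W e2"
    using e2(1) by (simp add: continuous_map_in_subtopology embedding_map_def homeomorphic_eq_everything_map)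
  have "homotopic_with (\<lambda>_. True) X2 (simplex_boundary n) (H \<circ> e2) (F \<circ> e2)"
    using H(3) by (intro homotopic_with_equal continuous_map_compose[OF e2c H(1)]) auto
  then have "homotopic_with (\<lambda>_. True) X2 (simplex_boundary n) (H \<circ> e2) h2"
    using hom2 homotopic_with_trans by blast
  from homotopy_extension_simplex_boundary[OF W e2 e1(2) _ H(1) this]
  obtain G where "continuous_map W (simplex_boundary n) G"
    "\<And>x. x \<in> topspace X2 \<Longrightarrow> G (e2 x) = h2 x" "\<And>w. w \<in> e1 ` topspace X1 \<Longrightarrow> G w = H w"
    using disj disjnt_sym by metis
  then show ?thesis using that H(2) by simp
qed

section \<open>The class of a cover\<close>

text \<open>
  Only the points where \<open>\<Phi> x i \<noteq> 0\<close> have to lie in \<open>U i\<close>, not their closure as for a partition of unity: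
  this condition is inherited by preimages and suffices for the straight-line homotopy below.
\<close>

definition carried_by :: "nat \<Rightarrow> 'a topology \<Rightarrow> (nat \<Rightarrow> 'a set) \<Rightarrow> ('a \<Rightarrow> nat \<Rightarrow> real) \<Rightarrow> bool" where
  "carried_by n X U \<Phi> \<longleftrightarrow>
     continuous_map X (simplex_boundary n) \<Phi> \<and>
     (\<forall>x\<in>topspace X. \<forall>i\<le>Suc n. \<Phi> x i \<noteq> 0 \<longrightarrow> x \<in> U i)"

lemma carried_by_mono:
  "carried_by n X U \<Phi> \<Longrightarrow> (\<And>i. i \<le> Suc n \<Longrightarrow> U i \<subseteq> V i) \<Longrightarrow> carried_by n X V \<Phi>"
  unfolding carried_by_def by blast

lemma partition_map_eq_simplex_point:
  assumes \<phi>: "partition_of_unity n X U \<phi>" and empty: "(\<Inter>i\<le>Suc n. U i) = {}"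
  obtains \<Phi> where "carried_by n X U \<Phi>" "partition_map n v \<phi> = simplex_point n v \<circ> \<Phi>"
proof -
  define \<Phi> where "\<Phi> x i = (if i \<le> Suc n then \<phi> i x else 0)" for x i
  have carrier: "x \<in> U i" if "x \<in> topspace X" "i \<le> Suc n" "\<phi> i x \<noteq> 0" for x i
  proof -
    have "x \<in> X closure_of {x \<in> topspace X. \<phi> i x \<noteq> 0}"
      using that closure_of_subset[of "{x \<in> topspace X. \<phi> i x \<noteq> 0}" X] by auto
    then show ?thesis using \<phi> that(2) by (auto simp: partition_of_unity_def)
  qed
  have "\<Phi> x \<in> topspace (simplex_boundary n)" if x: "x \<in> topspace X" for x
  proof -
    have "\<not> (\<forall>i\<le>Suc n. x \<in> U i)" using empty by blast
    then obtain k where "k \<le> Suc n" "\<phi> k x = 0" using carrier[OF x] by blast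
    moreover have "(\<Sum>i\<le>Suc n. \<Phi> x i) = (\<Sum>i\<le>Suc n. \<phi> i x)"
      by (intro sum.cong) (auto simp: \<Phi>_def)
    ultimately show ?thesis
      using \<phi> x unfolding topspace_simplex_boundary partition_of_unity_def
      by (simp add: \<Phi>_def del: sum.atMost_Suc) blast
  qed
  moreover have "continuous_map X euclideanreal (\<lambda>x. \<Phi> x i)" for i
    using \<phi> by (cases "i \<le> Suc n") (auto simp: \<Phi>_def partition_of_unity_def)
  ultimately have "carried_by n X U \<Phi>"
    using carrier unfolding carried_by_def continuous_map_simplex_boundary by (simp add: \<Phi>_def)
  moreover have "partition_map n v \<phi> = simplex_point n v \<circ> \<Phi>"
    by (intro ext) (auto simp: partition_map_def simplex_point_def \<Phi>_def intro: sum.cong)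
  ultimately show ?thesis using that by blast
qed

lemma exists_carried_by:
  assumes "normal_space X" "open_cover n X U" "(\<Inter>i\<le>Suc n. U i) = {}"
  obtains \<Phi> where "carried_by n X U \<Phi>"
  using exists_partition_of_unity[OF assms(1,2)] partition_map_eq_simplex_point[OF _ assms(3)] by metis

text \<open>
  The straight-line homotopy stays in the boundary of the simplex: at \<open>x\<close> the coordinate of an index
  \<open>i\<close> with \<open>x \<notin> U i\<close> vanishes throughout.
\<close>

lemma carried_by_homotopic:
  assumes \<Phi>: "carried_by n X U \<Phi>" and \<Psi>: "carried_by n X U \<Psi>" and empty: "(\<Inter>i\<le>Suc n. U i) = {}"
  shows "homotopic_with (\<lambda>_. True) X (simplex_boundary n) \<Phi> \<Psi>"
proof -
  define h where "h z i = (1 - fst z) * \<Phi> (snd z) i + fst z * \<Psi> (snd z) i" for z :: "real \<times> 'a" and i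
  let ?P = "prod_topology (top_of_set {0..1::real}) X"
  have "continuous_map ?P (simplex_boundary n) h"
    unfolding continuous_map_simplex_boundary
  proof (intro conjI allI ballI)
    fix i
    have c: "continuous_map X euclideanreal (\<lambda>x. \<Phi> x i)" "continuous_map X euclideanreal (\<lambda>x. \<Psi> x i)"
      using \<Phi> \<Psi> by (auto simp: carried_by_def continuous_map_simplex_boundary)
    have t: "continuous_map ?P euclideanreal fst"
      using continuous_map_fst by (rule continuous_map_into_fulltopology)
    show "continuous_map ?P euclideanreal (\<lambda>z. h z i)"
      unfolding h_def
      by (intro continuous_map_add continuous_map_real_mult continuous_map_diff t
          continuous_map_canonical_const continuous_map_compose[OF continuous_map_snd c(1), unfolded o_def]
          continuous_map_compose[OF continuous_map_snd c(2), unfolded o_def])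
  next
    fix z assume "z \<in> topspace ?P"
    then obtain t x where z: "z = (t, x)" "0 \<le> t" "t \<le> 1" and x: "x \<in> topspace X" by auto
    have ab: "\<Phi> x \<in> topspace (simplex_boundary n)" "\<Psi> x \<in> topspace (simplex_boundary n)"
      using \<Phi> \<Psi> x by (auto simp: carried_by_def continuous_map_simplex_boundary)
    obtain k where k: "k \<le> Suc n" "x \<notin> U k" using empty by blast
    then have "\<Phi> x k = 0" "\<Psi> x k = 0" using \<Phi> \<Psi> x by (auto simp: carried_by_def)
    then have "h z k = 0" by (simp add: h_def z)
    moreover have "(\<Sum>i\<le>Suc n. h z i) = (1 - t) * (\<Sum>i\<le>Suc n. \<Phi> x i) + t * (\<Sum>i\<le>Suc n. \<Psi> x i)"
      unfolding h_def z(1) fst_conv snd_conv by (simp only: sum.distrib sum_distrib_left)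
    then have "(\<Sum>i\<le>Suc n. h z i) = 1"
      using ab by (simp add: topspace_simplex_boundary del: sum.atMost_Suc)
    moreover have "0 \<le> h z i" if "i \<le> Suc n" for i
      using ab z that by (simp add: h_def topspace_simplex_boundary)
    moreover have "h z i = 0" if "i > Suc n" for i
      using ab z that by (simp add: h_def topspace_simplex_boundary)
    ultimately show "h z \<in> topspace (simplex_boundary n)"
      using k(1) unfolding topspace_simplex_boundary by blast
  qed
  moreover have "\<forall>x. h (0, x) = \<Phi> x" "\<forall>x. h (1, x) = \<Psi> x" by (auto simp: h_def)
  ultimately show ?thesis unfolding homotopic_with_def by blast
qed

lemma Inter_empty_mono:
  assumes "(\<Inter>i\<le>N. V i) = {}" "\<And>i. i \<le> N \<Longrightarrow> S i \<subseteq> V i"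
  shows "(\<Inter>i\<le>N. S i) = {}"
proof -
  have "(\<Inter>i\<le>N. S i) \<subseteq> (\<Inter>i\<le>N. V i)"
    using assms(2) by (intro INT_anti_mono) auto
  then show ?thesis using assms(1) by simp
qed

lemma cover_class_imp_open_cover:
  assumes f: "f \<in> cover_class n v X S" and empty: "(\<Inter>i\<le>Suc n. S i) = {}"
  obtains U where "open_cover n X U" "\<And>i. i \<le> Suc n \<Longrightarrow> S i \<subseteq> U i" "(\<Inter>i\<le>Suc n. U i) = {}"
    "f \<in> open_cover_class n v X U"
proof -
  consider "open_cover n X S" "f \<in> open_cover_class n v X S"
    | U where "open_cover n X U" "\<forall>i\<le>Suc n. S i \<subseteq> U i" "(\<Inter>i\<le>Suc n. U i) = {}"
        "f \<in> open_cover_class n v X U"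
    using f unfolding cover_class_def mem_Collect_eq by metis
  then show ?thesis
  proof cases
    case 1
    then show ?thesis using that[of S] empty by simp
  next
    case (2 U)
    then show ?thesis using that[of U] by simp
  qed
qed

lemma continuous_map_simplex_point:
  "simplex_vertices n v \<Longrightarrow> continuous_map (simplex_boundary n) (sphere_top n v) (simplex_point n v)"
  using homeomorphic_imp_continuous_map homeomorphic_map_simplex_point by blast

lemma open_cover_class_carried_by:
  assumes "f \<in> open_cover_class n v X U" "(\<Inter>i\<le>Suc n. U i) = {}"
  obtains \<Phi> where "carried_by n X U \<Phi>"
    "homotopic_with (\<lambda>_. True) X (sphere_top n v) (simplex_point n v \<circ> \<Phi>) f"
proof -
  obtain \<phi> where \<phi>: "partition_of_unity n X U \<phi>"
    "homotopic_with (\<lambda>_. True) X (sphere_top n v) (partition_map n v \<phi>) f"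
    using assms(1) by (auto simp: open_cover_class_def)
  obtain \<Phi> where "carried_by n X U \<Phi>" "partition_map n v \<phi> = simplex_point n v \<circ> \<Phi>"
    by (rule partition_map_eq_simplex_point[OF \<phi>(1) assms(2)])
  then show ?thesis using \<phi>(2) that by simp
qed

text \<open>
  Two open families around \<open>S\<close> are compared through their intersection, which still covers \<open>X\<close>
  because \<open>S\<close> does; this includes the case that \<open>S\<close> is itself open.
\<close>

lemma cover_class_homotopic:
  assumes X: "normal_space X" and v: "simplex_vertices n v"
    and f: "f \<in> cover_class n v X S"
    and V: "open_cover n X V" "\<And>i. i \<le> Suc n \<Longrightarrow> S i \<subseteq> V i" "(\<Inter>i\<le>Suc n. V i) = {}"
    and \<Phi>: "carried_by n X V \<Phi>"
  shows "homotopic_with (\<lambda>_. True) X (sphere_top n v) (simplex_point n v \<circ> \<Phi>) f"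
proof -
  have Sempty: "(\<Inter>i\<le>Suc n. S i) = {}" by (rule Inter_empty_mono[OF V(3,2)])
  obtain U where U: "open_cover n X U" "\<And>i. i \<le> Suc n \<Longrightarrow> S i \<subseteq> U i" "(\<Inter>i\<le>Suc n. U i) = {}"
    "f \<in> open_cover_class n v X U"
    by (rule cover_class_imp_open_cover[OF f Sempty]) (use that in blast)
  obtain \<Psi> where \<Psi>: "carried_by n X U \<Psi>"
    "homotopic_with (\<lambda>_. True) X (sphere_top n v) (simplex_point n v \<circ> \<Psi>) f"
    by (rule open_cover_class_carried_by[OF U(4,3)])
  have "(\<Union>i\<le>Suc n. S i) = topspace X"
    using f by (auto simp: cover_class_def open_cover_def closed_cover_def)
  moreover have "(\<Union>i\<le>Suc n. S i) \<subseteq> (\<Union>i\<le>Suc n. U i \<inter> V i)"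
    using U(2) V(2) by (intro UN_mono) auto
  moreover have "(\<Union>i\<le>Suc n. U i \<inter> V i) \<subseteq> topspace X"
    using U(1) unfolding open_cover_def by blast
  ultimately have "open_cover n X (\<lambda>i. U i \<inter> V i)"
    using U(1) V(1) unfolding open_cover_def by (simp add: openin_Int)
  moreover have "(\<Inter>i\<le>Suc n. U i \<inter> V i) = {}" by (rule Inter_empty_mono[OF U(3)]) simp
  ultimately obtain \<Theta> where \<Theta>: "carried_by n X (\<lambda>i. U i \<inter> V i) \<Theta>"
    by (rule exists_carried_by[OF X])
  have "carried_by n X V \<Theta>" "carried_by n X U \<Theta>"
    by (rule carried_by_mono[OF \<Theta>], simp)+
  then have "homotopic_with (\<lambda>_. True) X (simplex_boundary n) \<Phi> \<Psi>"
    by (intro homotopic_with_trans[OF carried_by_homotopic[OF \<Phi> _ V(3)]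
          carried_by_homotopic[OF _ \<Psi>(1) U(3)]])
  then have "homotopic_with (\<lambda>_. True) X (sphere_top n v) (simplex_point n v \<circ> \<Phi>) (simplex_point n v \<circ> \<Psi>)"
    by (rule homotopic_with_compose_continuous_map_left[OF _ continuous_map_simplex_point[OF v]]) simp
  then show ?thesis using \<Psi>(2) by (rule homotopic_with_trans)
qed

section \<open>Extending covers from a closed subset\<close>

text \<open>
  If \<open>g k\<close> is a nonnegative function with zero set \<open>D k\<close>, the sets where \<open>g k\<close> is the least of all
  the functions cover the space, and on the union of the \<open>D k\<close> the least value is 0.
\<close>

lemma extend_closed_cover:
  fixes D :: "nat \<Rightarrow> 'a set"
  assumes X: "normal_space X" "regular_space X" "second_countable X"
    and D: "\<And>k. k \<le> N \<Longrightarrow> closedin X (D k)"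
  obtains E where "\<And>k. k \<le> N \<Longrightarrow> closedin X (E k)" "(\<Union>k\<le>N. E k) = topspace X"
    "\<And>k. k \<le> N \<Longrightarrow> E k \<inter> (\<Union>j\<le>N. D j) = D k"
proof -
  have "\<exists>g. continuous_map X euclideanreal g \<and> (\<forall>x\<in>topspace X. 0 \<le> g x) \<and>
      (\<forall>x\<in>topspace X. g x = 0 \<longleftrightarrow> x \<in> D k)" if "k \<le> N" for k
    using closedin_imp_zero_set[OF X D[OF that]] by metis
  then obtain g where g: "\<And>k. k \<le> N \<Longrightarrow> continuous_map X euclideanreal (g k)"
    "\<And>k x. k \<le> N \<Longrightarrow> x \<in> topspace X \<Longrightarrow> 0 \<le> g k x"
    "\<And>k x. k \<le> N \<Longrightarrow> x \<in> topspace X \<Longrightarrow> g k x = 0 \<longleftrightarrow> x \<in> D k"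
    by metis
  define E where "E k = (\<Inter>j\<in>{..N}. {x \<in> topspace X. g k x \<le> g j x})" for k
  have DX: "D k \<subseteq> topspace X" if "k \<le> N" for k
    using D[OF that] by (rule closedin_subset)
  show thesis
  proof (rule that)
    show "closedin X (E k)" if "k \<le> N" for k
      unfolding E_def using g(1) that by (intro closedin_INT closedin_le_continuous_map) auto
    show "(\<Union>k\<le>N. E k) = topspace X"
    proof
      show "(\<Union>k\<le>N. E k) \<subseteq> topspace X" by (auto simp: E_def)
      show "topspace X \<subseteq> (\<Union>k\<le>N. E k)"
      proof
        fix x assume x: "x \<in> topspace X"
        obtain k where "is_arg_min (\<lambda>k. g k x) (\<lambda>k. k \<in> {..N}) k"
          using ex_is_arg_min_if_finite[of "{..N}" "\<lambda>k. g k x"] by auto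
        then have k: "k \<le> N" "\<And>j. j \<le> N \<Longrightarrow> g k x \<le> g j x"
          by (auto simp: is_arg_min_linorder)
        then show "x \<in> (\<Union>k\<le>N. E k)" using x k by (auto simp: E_def)
      qed
    qed
    show "E k \<inter> (\<Union>j\<le>N. D j) = D k" if k: "k \<le> N" for k
    proof (intro equalityI subsetI)
      fix x assume "x \<in> E k \<inter> (\<Union>j\<le>N. D j)"
      then obtain j where j: "j \<le> N" "x \<in> D j" and x: "x \<in> topspace X" "g k x \<le> g j x"
        by (auto simp: E_def)
      then have "g k x \<le> 0" using g(3)[OF j(1) x(1)] by simp
      then show "x \<in> D k" using g(2)[OF k x(1)] g(3)[OF k x(1)] by simp
    next
      fix x assume x: "x \<in> D k"
      then have xX: "x \<in> topspace X" using DX[OF k] by blast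
      then have "g k x = 0" using g(3)[OF k] x by simp
      then show "x \<in> E k \<inter> (\<Union>j\<le>N. D j)" using x xX k g(2) by (auto simp: E_def)
    qed
  qed
qed

lemma simplex_boundary_big_coordinate:
  assumes "a \<in> topspace (simplex_boundary n)"
  shows "\<exists>k\<le>Suc n. 1 / (real n + 3) < a k"
proof (rule ccontr)
  assume "\<not> ?thesis"
  then have "(\<Sum>k\<le>Suc n. a k) \<le> (\<Sum>k\<le>Suc n. 1 / (real n + 3))"
    by (intro sum_mono) (simp add: not_less)
  also have "\<dots> = (real n + 2) / (real n + 3)" by simp
  also have "\<dots> < 1" by simp
  finally show False using assms by (simp add: topspace_simplex_boundary)
qed

text \<open>
  A map with values in the boundary of the simplex provides the closed sets \<open>K k\<close> where its coordinate
  \<open>k\<close> is at least \<open>1 / (n + 3)\<close>; this bound is less than the average \<open>1 / (n + 2)\<close> of the coordinates, so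
  the \<open>K k\<close> cover the space.  They are used away from \<open>A\<close>, and near \<open>A\<close> an extension \<open>E k\<close> of the cover
  \<open>S k\<close> of \<open>A\<close> is used.  On \<open>A\<close> both kinds of sets lie in \<open>U k\<close>, so the sets \<open>E k \<union> K k\<close> have no common
  point in \<open>A\<close>; as the common points form a closed set, they stay away from a neighbourhood of \<open>A\<close>.
\<close>

lemma extend_closed_cover_along_map:
  assumes W: "normal_space W" "regular_space W" "second_countable W"
    and S: "\<And>k. k \<le> Suc n \<Longrightarrow> closedin W (S k)" and A: "A = (\<Union>k\<le>Suc n. S k)"
    and a: "continuous_map W (simplex_boundary n) a"
    and U: "\<And>k. k \<le> Suc n \<Longrightarrow> S k \<subseteq> U k" "(\<Inter>k\<le>Suc n. U k) = {}"
    and aU: "\<And>w k. w \<in> A \<Longrightarrow> k \<le> Suc n \<Longrightarrow> a w k \<noteq> 0 \<Longrightarrow> w \<in> U k"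
  obtains Q where "closed_cover n W Q" "(\<Inter>k\<le>Suc n. Q k) = {}" "\<And>k. k \<le> Suc n \<Longrightarrow> Q k \<inter> A = S k"
proof -
  obtain E where E: "\<And>k. k \<le> Suc n \<Longrightarrow> closedin W (E k)" "(\<Union>k\<le>Suc n. E k) = topspace W"
    "\<And>k. k \<le> Suc n \<Longrightarrow> E k \<inter> A = S k"
    by (rule extend_closed_cover[OF W, of "Suc n" S, OF S]) (assumption+, rule that, simp_all only: A)
  define K where "K k = {w \<in> topspace W. 1 / (real n + 3) \<le> a w k}" for k
  have K: "closedin W (K k)" for k
    unfolding K_def using a
    by (intro closedin_le_continuous_map) (auto simp: continuous_map_simplex_boundary)
  have clA: "closedin W A" unfolding A using S by (intro closedin_Union) auto
  define T where "T = (\<Inter>k\<in>{..Suc n}. E k \<union> K k)"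
  have clT: "closedin W T" unfolding T_def using E(1) K by (intro closedin_INT closedin_Un) auto
  have "A \<inter> T = {}"
  proof (rule ccontr)
    assume "A \<inter> T \<noteq> {}"
    then obtain w where w: "w \<in> A" "\<forall>k\<le>Suc n. w \<in> E k \<union> K k" by (auto simp: T_def)
    have "w \<in> U k" if k: "k \<le> Suc n" for k
    proof (cases "w \<in> E k")
      case True
      then show ?thesis using E(3)[OF k] U(1)[OF k] w(1) by blast
    next
      case False
      then have "1 / (real n + 3) \<le> a w k" using w(2) k by (auto simp: K_def)
      moreover have "0 < 1 / (real n + 3)" by simp
      ultimately have "a w k \<noteq> 0" by linarith
      then show ?thesis using aU[OF w(1) k] by blast
    qed
    then show False using U(2) by blast
  qed
  then have "A \<subseteq> topspace W - T" using closedin_subset[OF clA] by blast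
  moreover have "openin W (topspace W - T)" using clT by blast
  ultimately obtain V where V: "openin W V" "A \<subseteq> V" "W closure_of V \<subseteq> topspace W - T"
    using W(1) clA unfolding normal_space_alt by meson
  define N where "N = W closure_of V"
  have N: "closedin W N" "V \<subseteq> N" "N \<inter> T = {}"
    using V closure_of_subset[OF openin_subset[OF V(1)]] by (auto simp: N_def)
  \<comment> \<open>Between \<open>V\<close> and \<open>N\<close> both kinds of sets are present; there \<open>T\<close> has been excluded.\<close>
  define Q where "Q k = E k \<inter> N \<union> (K k - V)" for k
  have ab: "a w \<in> topspace (simplex_boundary n)" if "w \<in> topspace W" for w
    using a that by (simp add: continuous_map_simplex_boundary)
  have QW: "Q k \<subseteq> topspace W" if "k \<le> Suc n" for k
    using closedin_subset[OF N(1)] by (auto simp: Q_def K_def)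
  show thesis
  proof (rule that)
    show "closed_cover n W Q"
      unfolding closed_cover_def
    proof (intro conjI allI impI equalityI subsetI)
      show "closedin W (Q k)" if "k \<le> Suc n" for k
        unfolding Q_def using E(1)[OF that] K N(1) V(1) by (intro closedin_Un closedin_Int closedin_diff)
      show "w \<in> topspace W" if "w \<in> (\<Union>k\<le>Suc n. Q k)" for w using that QW by blast
      show "w \<in> (\<Union>k\<le>Suc n. Q k)" if w: "w \<in> topspace W" for w
      proof (cases "w \<in> N")
        case True
        obtain k where "k \<le> Suc n" "w \<in> E k" using E(2) w by blast
        then show ?thesis using True by (auto simp: Q_def)
      next
        case False
        obtain k where "k \<le> Suc n" "1 / (real n + 3) < a w k"
          using simplex_boundary_big_coordinate[OF ab[OF w]] by blast
        then have "k \<le> Suc n" "w \<in> Q k" using False N(2) w by (auto simp: Q_def K_def)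
        then show ?thesis by blast
      qed
    qed
    show "Q k \<inter> A = S k" if "k \<le> Suc n" for k
      using E(3)[OF that] V(2) N(2) by (auto simp: Q_def)
    show "(\<Inter>k\<le>Suc n. Q k) = {}"
    proof (rule ccontr)
      assume "(\<Inter>k\<le>Suc n. Q k) \<noteq> {}"
      then obtain w where w: "\<forall>k\<le>Suc n. w \<in> Q k" by blast
      show False
      proof (cases "w \<in> N")
        case True
        then have "w \<in> T" using w by (auto simp: T_def Q_def)
        then show False using True N(3) by blast
      next
        case False
        then have K': "\<forall>k\<le>Suc n. w \<in> K k" using w by (auto simp: Q_def)
        then have wW: "w \<in> topspace W" by (auto simp: K_def)
        obtain k where "k \<le> Suc n" "a w k = 0"
          using ab[OF wW] by (auto simp: topspace_simplex_boundary)
        then have "1 / (real n + 3) \<le> 0" using K' by (auto simp: K_def)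
        then show False by (simp add: field_simps)
      qed
    qed
  qed
qed

text \<open>
  Dually, the complements of the \<open>S k\<close> in \<open>A\<close> form a closed cover of \<open>A\<close>, and the complements of an
  extension \<open>E k\<close> of that cover form an open family with empty intersection.  Near \<open>A\<close> it contains
  the sets \<open>P k\<close> where coordinate \<open>k\<close> is large, so adding these creates no common point.
\<close>

lemma extend_open_cover_along_map:
  assumes W: "normal_space W" "regular_space W" "second_countable W"
    and S: "\<And>k. k \<le> Suc n \<Longrightarrow> S k \<subseteq> A" "\<And>k. k \<le> Suc n \<Longrightarrow> closedin W (A - S k)"
    and empty: "(\<Inter>k\<le>Suc n. S k) = {}"
    and a: "continuous_map W (simplex_boundary n) a"
    and aS: "\<And>w k. w \<in> A \<Longrightarrow> k \<le> Suc n \<Longrightarrow> a w k \<noteq> 0 \<Longrightarrow> w \<in> S k"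
  obtains Q where "open_cover n W Q" "(\<Inter>k\<le>Suc n. Q k) = {}" "\<And>k. k \<le> Suc n \<Longrightarrow> Q k \<inter> A = S k"
proof -
  have A: "(\<Union>k\<le>Suc n. A - S k) = A" using empty by blast
  obtain E where E: "\<And>k. k \<le> Suc n \<Longrightarrow> closedin W (E k)" "(\<Union>k\<le>Suc n. E k) = topspace W"
    "\<And>k. k \<le> Suc n \<Longrightarrow> E k \<inter> (\<Union>j\<le>Suc n. A - S j) = A - S k"
    by (rule extend_closed_cover[OF W, of "Suc n" "\<lambda>j. A - S j", OF S(2)]) (assumption+, rule that, simp_all)
  have EA: "E k \<inter> A = A - S k" if "k \<le> Suc n" for k
    using E(3)[OF that] by (simp only: A)
  let ?\<epsilon> = "1 / (real n + 3)"
  have \<epsilon>: "0 < ?\<epsilon>" by simp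
  define K where "K k = {w \<in> topspace W. ?\<epsilon> \<le> a w k}" for k
  define P where "P k = {w \<in> topspace W. ?\<epsilon> < a w k}" for k
  have K: "closedin W (K k)" for k
    unfolding K_def using a
    by (intro closedin_le_continuous_map) (auto simp: continuous_map_simplex_boundary)
  have P: "openin W (P k)" "P k \<subseteq> K k" for k
    unfolding P_def K_def using a
    by (auto intro!: openin_less_continuous_map simp: continuous_map_simplex_boundary)
  have KS: "w \<in> S k" if "w \<in> K k" "w \<in> A" "k \<le> Suc n" for w k
    using that aS[of w k] \<epsilon> by (force simp: K_def)
  have ab: "a w \<in> topspace (simplex_boundary n)" if "w \<in> topspace W" for w
    using a that by (simp add: continuous_map_simplex_boundary)
  have AW: "A \<subseteq> topspace W" using closedin_subset[OF S(2)] A by blast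
  \<comment> \<open>On \<open>N\<close> the set \<open>K k\<close>, and with it \<open>P k\<close>, avoids \<open>E k\<close>.\<close>
  define N where "N = topspace W - (\<Union>k\<in>{..Suc n}. K k \<inter> E k)"
  have "closedin W (\<Union>k\<in>{..Suc n}. K k \<inter> E k)"
    using K E(1) by (intro closedin_Union) auto
  then have N: "openin W N" unfolding N_def by blast
  have AN: "A \<subseteq> N"
    using AW KS EA unfolding N_def by blast
  define Q where "Q k = (topspace W - E k) \<inter> N \<union> P k" for k
  show thesis
  proof (rule that)
    show "open_cover n W Q"
      unfolding open_cover_def
    proof (intro conjI allI impI equalityI subsetI)
      show "openin W (Q k)" if "k \<le> Suc n" for k
        unfolding Q_def using E(1)[OF that] P(1) N by (intro openin_Un openin_Int) auto
      show "w \<in> topspace W" if "w \<in> (\<Union>k\<le>Suc n. Q k)" for w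
        using that by (auto simp: Q_def P_def)
      show "w \<in> (\<Union>k\<le>Suc n. Q k)" if w: "w \<in> topspace W" for w
      proof -
        obtain k where "k \<le> Suc n" "?\<epsilon> < a w k"
          using simplex_boundary_big_coordinate[OF ab[OF w]] by blast
        then have "k \<le> Suc n" "w \<in> Q k" using w by (auto simp: Q_def P_def)
        then show ?thesis by blast
      qed
    qed
    show "Q k \<inter> A = S k" if "k \<le> Suc n" for k
      using EA[OF that] AN AW KS[OF _ _ that] P(2)[of k] S(1)[OF that] unfolding Q_def by blast
    show "(\<Inter>k\<le>Suc n. Q k) = {}"
    proof (rule ccontr)
      assume "(\<Inter>k\<le>Suc n. Q k) \<noteq> {}"
      then obtain w where w: "\<forall>k\<le>Suc n. w \<in> Q k" by blast
      then have wW: "w \<in> topspace W" by (auto simp: Q_def P_def)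
      show False
      proof (cases "w \<in> N")
        case True
        then have "w \<notin> E k" if "k \<le> Suc n" for k
          using w that P(2)[of k] unfolding Q_def N_def by blast
        then show False using E(2) wW by blast
      next
        case False
        then have P': "\<forall>k\<le>Suc n. w \<in> P k" using w by (auto simp: Q_def)
        obtain k where "k \<le> Suc n" "a w k = 0"
          using ab[OF wW] by (auto simp: topspace_simplex_boundary)
        then have "?\<epsilon> < 0" using P' by (auto simp: P_def)
        then show False using \<epsilon> by linarith
      qed
    qed
  qed
qed

section \<open>Covers and maps on the boundary of a space\<close>

lemma homotopy_extension_sphere:
  assumes v: "simplex_vertices n v"
    and W: "compact_space W" "Hausdorff_space W"
    and e1: "embedding_map X1 W e1" "closedin W (e1 ` topspace X1)"
    and e2: "embedding_map X2 W e2" "closedin W (e2 ` topspace X2)"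
    and disj: "disjnt (e1 ` topspace X1) (e2 ` topspace X2)"
    and F: "continuous_map W (sphere_top n v) F"
    and hom1: "homotopic_with (\<lambda>_. True) X1 (sphere_top n v) (F \<circ> e1) h1"
    and hom2: "homotopic_with (\<lambda>_. True) X2 (sphere_top n v) (F \<circ> e2) h2"
  obtains G where "continuous_map W (sphere_top n v) G"
    "\<And>x. x \<in> topspace X1 \<Longrightarrow> G (e1 x) = h1 x" "\<And>x. x \<in> topspace X2 \<Longrightarrow> G (e2 x) = h2 x"
proof -
  obtain b where "homeomorphic_maps (simplex_boundary n) (sphere_top n v) (simplex_point n v) b"
    using homeomorphic_map_simplex_point[OF v] by (auto simp: homeomorphic_map_maps)
  then have b: "continuous_map (sphere_top n v) (simplex_boundary n) b"
    "\<And>y. y \<in> topspace (sphere_top n v) \<Longrightarrow> simplex_point n v (b y) = y"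
    by (auto simp: homeomorphic_maps_def)
  have "homotopic_with (\<lambda>_. True) X1 (simplex_boundary n) ((b \<circ> F) \<circ> e1) (b \<circ> h1)"
    "homotopic_with (\<lambda>_. True) X2 (simplex_boundary n) ((b \<circ> F) \<circ> e2) (b \<circ> h2)"
    using homotopic_with_compose_continuous_map_left[OF hom1 b(1)]
      homotopic_with_compose_continuous_map_left[OF hom2 b(1)] by (simp_all add: comp_assoc)
  from homotopy_extension_two[OF W e1 e2 disj continuous_map_compose[OF F b(1)] this]
  obtain G where G: "continuous_map W (simplex_boundary n) G"
    "\<And>x. x \<in> topspace X1 \<Longrightarrow> G (e1 x) = (b \<circ> h1) x" "\<And>x. x \<in> topspace X2 \<Longrightarrow> G (e2 x) = (b \<circ> h2) x"
    by blast
  have h: "h1 x \<in> topspace (sphere_top n v)" if "x \<in> topspace X1" for x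
    using homotopic_with_imp_continuous_maps[OF hom1] that by (auto simp: continuous_map_def Pi_iff)
  have h': "h2 x \<in> topspace (sphere_top n v)" if "x \<in> topspace X2" for x
    using homotopic_with_imp_continuous_maps[OF hom2] that by (auto simp: continuous_map_def Pi_iff)
  show thesis
  proof (rule that)
    show "continuous_map W (sphere_top n v) (simplex_point n v \<circ> G)"
      using G(1) continuous_map_simplex_point[OF v] by (rule continuous_map_compose)
  qed (use G(2,3) b(2) h h' in auto)
qed

lemma embedding_imp_continuous_map: "embedding_map X Y e \<Longrightarrow> continuous_map X Y e"
  by (simp add: continuous_map_in_subtopology embedding_map_def homeomorphic_eq_everything_map)

lemma embedding_imp_inj_on: "embedding_map X Y e \<Longrightarrow> inj_on e (topspace X)"
  by (simp add: embedding_map_def homeomorphic_eq_everything_map)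

lemma closed_embedding_image:
  assumes e: "embedding_map X W e" "closedin W (e ` topspace X)" and C: "closedin X C"
  shows "closedin W (e ` C)"
proof -
  have "homeomorphic_map X (subtopology W (e ` topspace X)) e"
    using e(1) by (simp add: embedding_map_def)
  then have "closedin (subtopology W (e ` topspace X)) (e ` C)"
    using C homeomorphic_map_closedness closedin_subset by metis
  then show ?thesis using e(2) closedin_trans_full by blast
qed

lemma open_cover_preimage:
  assumes e: "continuous_map X W e" and U: "open_cover n W U"
  shows "open_cover n X (\<lambda>k. {x \<in> topspace X. e x \<in> U k})"
  unfolding open_cover_def
proof (intro conjI allI impI)
  show "openin X {x \<in> topspace X. e x \<in> U k}" if "k \<le> Suc n" for k
    using openin_continuous_map_preimage[OF e] U that by (simp add: open_cover_def)
  have "e x \<in> (\<Union>k\<le>Suc n. U k)" if "x \<in> topspace X" for x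
    using e U that by (auto simp: continuous_map_def Pi_iff open_cover_def)
  then show "(\<Union>k\<le>Suc n. {x \<in> topspace X. e x \<in> U k}) = topspace X" by blast
qed

text \<open>Naturality of the class: restricting an associated map gives one for the restricted cover.\<close>

lemma associated_map_of_restricted_cover:
  assumes v: "simplex_vertices n v" and X: "normal_space X" and e: "continuous_map X W e"
    and U: "open_cover n W U" "(\<Inter>k\<le>Suc n. U k) = {}" and \<Phi>: "carried_by n W U \<Phi>"
    and S: "\<And>k. k \<le> Suc n \<Longrightarrow> S k \<subseteq> topspace X" "\<And>k. k \<le> Suc n \<Longrightarrow> e ` S k \<subseteq> U k"
    and f: "f \<in> cover_class n v X S"
  shows "homotopic_with (\<lambda>_. True) X (sphere_top n v) ((simplex_point n v \<circ> \<Phi>) \<circ> e) f"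
proof -
  let ?V = "\<lambda>k. {x \<in> topspace X. e x \<in> U k}"
  have "carried_by n X ?V (\<Phi> \<circ> e)"
    using \<Phi> e continuous_map_compose[OF e] unfolding carried_by_def
    by (auto simp: continuous_map_def Pi_iff)
  moreover have "(\<Inter>k\<le>Suc n. ?V k) = {}"
    using U(2) by auto
  moreover have "S k \<subseteq> ?V k" if "k \<le> Suc n" for k
    using S[OF that] by auto
  ultimately show ?thesis
    using cover_class_homotopic[OF X v f open_cover_preimage[OF e U(1)]] by (simp add: comp_assoc)
qed

text \<open>
  A closed cover is first enlarged to an open one, which is possible over \<open>W\<close> and restricts to
  neighbourhoods of the given covers; the associated map over \<open>W\<close> is then corrected by a homotopy.
\<close>

lemma extended_cover_imp_extended_map:
  assumes v: "simplex_vertices n v"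
    and W: "compact_space W" "Hausdorff_space W"
    and X: "normal_space X1" "normal_space X2"
    and e1: "embedding_map X1 W e1" "closedin W (e1 ` topspace X1)"
    and e2: "embedding_map X2 W e2" "closedin W (e2 ` topspace X2)"
    and disj: "disjnt (e1 ` topspace X1) (e2 ` topspace X2)"
    and f: "f1 \<in> cover_class n v X1 S1" "f2 \<in> cover_class n v X2 S2"
    and Q: "is_cover n W Q" "(\<Inter>k\<le>Suc n. Q k) = {}"
      "\<And>k. k \<le> Suc n \<Longrightarrow> {x \<in> topspace X1. e1 x \<in> Q k} = S1 k"
      "\<And>k. k \<le> Suc n \<Longrightarrow> {x \<in> topspace X2. e2 x \<in> Q k} = S2 k"
  obtains F where "continuous_map W (sphere_top n v) F"
    "\<And>x. x \<in> topspace X1 \<Longrightarrow> F (e1 x) = f1 x" "\<And>x. x \<in> topspace X2 \<Longrightarrow> F (e2 x) = f2 x"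
proof -
  have nW: "normal_space W"
    using W by (simp add: compact_Hausdorff_or_regular_imp_normal_space)
  obtain f where "f \<in> cover_class n v W Q"
    using cover_class_nonempty[OF nW v Q(1,2)] by blast
  then obtain U where U: "open_cover n W U" "\<And>k. k \<le> Suc n \<Longrightarrow> Q k \<subseteq> U k" "(\<Inter>k\<le>Suc n. U k) = {}"
    by (rule cover_class_imp_open_cover[OF _ Q(2)]) (use that in blast)
  obtain \<Phi> where \<Phi>: "carried_by n W U \<Phi>"
    by (rule exists_carried_by[OF nW U(1,3)])
  let ?F = "simplex_point n v \<circ> \<Phi>"
  have "continuous_map W (sphere_top n v) ?F"
    using \<Phi> continuous_map_compose continuous_map_simplex_point[OF v] by (metis carried_by_def)
  moreover have "homotopic_with (\<lambda>_. True) X1 (sphere_top n v) (?F \<circ> e1) f1"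
    by (rule associated_map_of_restricted_cover[OF v X(1) embedding_imp_continuous_map[OF e1(1)]
          U(1,3) \<Phi> _ _ f(1)]) (use U(2) Q(3) in blast)+
  moreover have "homotopic_with (\<lambda>_. True) X2 (sphere_top n v) (?F \<circ> e2) f2"
    by (rule associated_map_of_restricted_cover[OF v X(2) embedding_imp_continuous_map[OF e2(1)]
          U(1,3) \<Phi> _ _ f(2)]) (use U(2) Q(4) in blast)+
  ultimately show thesis
    by (rule homotopy_extension_sphere[OF v W e1 e2 disj]) (rule that)
qed

lemma mem_glued_iff:
  assumes "inj_on e1 X1" "inj_on e2 X2" "disjnt (e1 ` X1) (e2 ` X2)" "T1 \<subseteq> X1" "T2 \<subseteq> X2"
  shows "x \<in> X1 \<Longrightarrow> e1 x \<in> e1 ` T1 \<union> e2 ` T2 \<longleftrightarrow> x \<in> T1"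
    and "y \<in> X2 \<Longrightarrow> e2 y \<in> e1 ` T1 \<union> e2 ` T2 \<longleftrightarrow> y \<in> T2"
  using assms unfolding disjnt_iff inj_on_def by blast+

lemma Inter_glued_empty:
  fixes N :: nat
  assumes inj: "inj_on e1 X1" "inj_on e2 X2" "disjnt (e1 ` X1) (e2 ` X2)"
    and T: "\<And>k. k \<le> N \<Longrightarrow> T1 k \<subseteq> X1" "\<And>k. k \<le> N \<Longrightarrow> T2 k \<subseteq> X2"
    and empty: "(\<Inter>k\<le>N. T1 k) = {}" "(\<Inter>k\<le>N. T2 k) = {}"
  shows "(\<Inter>k\<le>N. e1 ` T1 k \<union> e2 ` T2 k) = {}"
proof (rule ccontr)
  assume "\<not> ?thesis"
  then obtain w where "w \<in> (\<Inter>k\<le>N. e1 ` T1 k \<union> e2 ` T2 k)" by (meson ex_in_conv)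
  then have w: "w \<in> e1 ` T1 k \<union> e2 ` T2 k" if "k \<le> N" for k
    using that by (elim INT_E[where a = k]) auto
  have "w \<in> e1 ` X1 \<union> e2 ` X2"
    using w[OF le0] T(1)[OF le0] T(2)[OF le0] by blast
  then consider x where "x \<in> X1" "w = e1 x" | y where "y \<in> X2" "w = e2 y" by auto
  then show False
  proof cases
    case (1 x)
    then have "x \<in> T1 k" if "k \<le> N" for k
      using w[OF that] mem_glued_iff(1)[OF inj T(1)[OF that] T(2)[OF that]] by simp
    then show False using empty(1) by blast
  next
    case (2 y)
    then have "y \<in> T2 k" if "k \<le> N" for k
      using w[OF that] mem_glued_iff(2)[OF inj T(1)[OF that] T(2)[OF that]] by simp
    then show False using empty(2) by blast
  qed
qed

text \<open>
  The two covers are glued to a cover \<open>T\<close> of the union \<open>A\<close> of the embedded spaces, and extended from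
  there along a map that is associated with them on \<open>A\<close>.  An open cover is its own neighbourhood;
  for a closed one, an open family \<open>U\<close> around it comes with the given homotopy class.
\<close>

lemma extended_map_imp_extended_cover:
  assumes v: "simplex_vertices n v"
    and W: "compact_space W" "Hausdorff_space W" "second_countable W"
    and X: "normal_space X1" "normal_space X2"
    and e1: "embedding_map X1 W e1" "closedin W (e1 ` topspace X1)"
    and e2: "embedding_map X2 W e2" "closedin W (e2 ` topspace X2)"
    and disj: "disjnt (e1 ` topspace X1) (e2 ` topspace X2)"
    and S: "open_cover n X1 S1 \<and> open_cover n X2 S2 \<or> closed_cover n X1 S1 \<and> closed_cover n X2 S2"
    and empty: "(\<Inter>k\<le>Suc n. S1 k) = {}" "(\<Inter>k\<le>Suc n. S2 k) = {}"
    and f: "f1 \<in> cover_class n v X1 S1" "f2 \<in> cover_class n v X2 S2"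
    and F: "continuous_map W (sphere_top n v) F"
      "\<And>x. x \<in> topspace X1 \<Longrightarrow> F (e1 x) = f1 x" "\<And>x. x \<in> topspace X2 \<Longrightarrow> F (e2 x) = f2 x"
  obtains Q where "is_cover n W Q" "(\<Inter>k\<le>Suc n. Q k) = {}"
      "\<And>k. k \<le> Suc n \<Longrightarrow> {x \<in> topspace X1. e1 x \<in> Q k} = S1 k"
      "\<And>k. k \<le> Suc n \<Longrightarrow> {x \<in> topspace X2. e2 x \<in> Q k} = S2 k"
proof -
  have nW: "normal_space W" "regular_space W"
    using W by (simp_all add: compact_Hausdorff_or_regular_imp_normal_space
        compact_Hausdorff_imp_regular_space)
  have inj: "inj_on e1 (topspace X1)" "inj_on e2 (topspace X2)"
    using e1(1) e2(1) by (auto intro: embedding_imp_inj_on)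
  have SX: "S1 k \<subseteq> topspace X1" "S2 k \<subseteq> topspace X2" if "k \<le> Suc n" for k
    using S that by (auto simp: open_cover_def closed_cover_def dest: openin_subset closedin_subset)
  have cover: "(\<Union>k\<le>Suc n. S1 k) = topspace X1" "(\<Union>k\<le>Suc n. S2 k) = topspace X2"
    using S unfolding open_cover_def closed_cover_def by blast+
  define A where "A = e1 ` topspace X1 \<union> e2 ` topspace X2"
  define T where "T k = e1 ` S1 k \<union> e2 ` S2 k" for k
  have T: "{x \<in> topspace X1. e1 x \<in> Q k} = S1 k \<and> {x \<in> topspace X2. e2 x \<in> Q k} = S2 k"
    if "Q k \<inter> A = T k" "k \<le> Suc n" for Q k
  proof -
    have "e1 x \<in> Q k \<longleftrightarrow> x \<in> S1 k" if "x \<in> topspace X1" for x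
      using \<open>Q k \<inter> A = T k\<close> that mem_glued_iff(1)[OF inj disj SX[OF \<open>k \<le> Suc n\<close>] that]
      unfolding T_def A_def by blast
    moreover have "e2 x \<in> Q k \<longleftrightarrow> x \<in> S2 k" if "x \<in> topspace X2" for x
      using \<open>Q k \<inter> A = T k\<close> that mem_glued_iff(2)[OF inj disj SX[OF \<open>k \<le> Suc n\<close>] that]
      unfolding T_def A_def by blast
    ultimately show ?thesis using SX[OF that(2)] by blast
  qed
  obtain b where "homeomorphic_maps (simplex_boundary n) (sphere_top n v) (simplex_point n v) b"
    using homeomorphic_map_simplex_point[OF v] by (auto simp: homeomorphic_map_maps)
  then have b: "continuous_map (sphere_top n v) (simplex_boundary n) b"
    "\<And>a. a \<in> topspace (simplex_boundary n) \<Longrightarrow> b (simplex_point n v a) = a"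
    by (auto simp: homeomorphic_maps_def)
  \<comment> \<open>The map can be changed so that its coordinates on the closed subset are carried by the
    neighbourhoods of the given cover.\<close>
  have carried: "\<exists>a. continuous_map W (simplex_boundary n) a \<and>
      (\<forall>w\<in>A. \<forall>k\<le>Suc n. a w k \<noteq> 0 \<longrightarrow> w \<in> e1 ` (U1 k \<inter> topspace X1) \<union> e2 ` (U2 k \<inter> topspace X2))"
    if \<Phi>: "carried_by n X1 U1 \<Phi>1" "carried_by n X2 U2 \<Phi>2"
      and h: "homotopic_with (\<lambda>_. True) X1 (sphere_top n v) (simplex_point n v \<circ> \<Phi>1) f1"
        "homotopic_with (\<lambda>_. True) X2 (sphere_top n v) (simplex_point n v \<circ> \<Phi>2) f2"
    for U1 \<Phi>1 U2 \<Phi>2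
  proof -
    have "homotopic_with (\<lambda>_. True) X1 (sphere_top n v) (F \<circ> e1) f1"
      "homotopic_with (\<lambda>_. True) X2 (sphere_top n v) (F \<circ> e2) f2"
      using F(2,3) continuous_map_compose[OF embedding_imp_continuous_map[OF e1(1)] F(1)]
        continuous_map_compose[OF embedding_imp_continuous_map[OF e2(1)] F(1)]
      by (auto intro: homotopic_with_equal)
    then have "homotopic_with (\<lambda>_. True) X1 (sphere_top n v) (F \<circ> e1) (simplex_point n v \<circ> \<Phi>1)"
      "homotopic_with (\<lambda>_. True) X2 (sphere_top n v) (F \<circ> e2) (simplex_point n v \<circ> \<Phi>2)"
      using h[THEN homotopic_with_symD] by (blast intro: homotopic_with_trans)+
    then obtain G where G: "continuous_map W (sphere_top n v) G"
      "\<And>x. x \<in> topspace X1 \<Longrightarrow> G (e1 x) = (simplex_point n v \<circ> \<Phi>1) x"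
      "\<And>x. x \<in> topspace X2 \<Longrightarrow> G (e2 x) = (simplex_point n v \<circ> \<Phi>2) x"
      using homotopy_extension_sphere[OF v W(1,2) e1 e2 disj F(1)] by metis
    have "(b \<circ> G) (e1 x) = \<Phi>1 x" if "x \<in> topspace X1" for x
      using G(2) b(2) \<Phi>(1) that by (simp add: carried_by_def continuous_map_simplex_boundary)
    moreover have "(b \<circ> G) (e2 x) = \<Phi>2 x" if "x \<in> topspace X2" for x
      using G(3) b(2) \<Phi>(2) that by (simp add: carried_by_def continuous_map_simplex_boundary)
    ultimately have "\<forall>w\<in>A. \<forall>k\<le>Suc n. (b \<circ> G) w k \<noteq> 0 \<longrightarrow>
        w \<in> e1 ` (U1 k \<inter> topspace X1) \<union> e2 ` (U2 k \<inter> topspace X2)"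
      using \<Phi> unfolding A_def carried_by_def by (auto simp del: o_apply)
    then show ?thesis using continuous_map_compose[OF G(1) b(1)] by blast
  qed
  from S show thesis
  proof
    assume op: "open_cover n X1 S1 \<and> open_cover n X2 S2"
    obtain \<Phi>1 where \<Phi>1: "carried_by n X1 S1 \<Phi>1"
      using exists_carried_by[OF X(1) _ empty(1)] op by blast
    obtain \<Phi>2 where \<Phi>2: "carried_by n X2 S2 \<Phi>2"
      using exists_carried_by[OF X(2) _ empty(2)] op by blast
    have "homotopic_with (\<lambda>_. True) X1 (sphere_top n v) (simplex_point n v \<circ> \<Phi>1) f1"
      using cover_class_homotopic[OF X(1) v f(1) _ _ empty(1) \<Phi>1] op by simp
    moreover have "homotopic_with (\<lambda>_. True) X2 (sphere_top n v) (simplex_point n v \<circ> \<Phi>2) f2"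
      using cover_class_homotopic[OF X(2) v f(2) _ _ empty(2) \<Phi>2] op by simp
    ultimately obtain a where a: "continuous_map W (simplex_boundary n) a"
      "\<forall>w\<in>A. \<forall>k\<le>Suc n. a w k \<noteq> 0 \<longrightarrow> w \<in> e1 ` (S1 k \<inter> topspace X1) \<union> e2 ` (S2 k \<inter> topspace X2)"
      using carried[OF \<Phi>1 \<Phi>2] by blast
    have aT: "w \<in> T k" if "w \<in> A" "k \<le> Suc n" "a w k \<noteq> 0" for w k
      using a(2) that unfolding T_def by blast
    have TA: "T k \<subseteq> A" if "k \<le> Suc n" for k
      using SX[OF that] unfolding T_def A_def by blast
    have AT: "closedin W (A - T k)" if k: "k \<le> Suc n" for k
    proof -
      have "A - T k = e1 ` (topspace X1 - S1 k) \<union> e2 ` (topspace X2 - S2 k)"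
        using inj disj SX[OF k] unfolding A_def T_def inj_on_def disjnt_iff by blast
      moreover have "closedin X1 (topspace X1 - S1 k)" "closedin X2 (topspace X2 - S2 k)"
        using op k by (auto simp: open_cover_def)
      ultimately show ?thesis
        using closed_embedding_image[OF e1] closed_embedding_image[OF e2] by (simp add: closedin_Un)
    qed
    have Tempty: "(\<Inter>k\<le>Suc n. T k) = {}"
      unfolding T_def by (rule Inter_glued_empty[where ?T1.0 = S1 and ?T2.0 = S2, OF inj disj SX empty])
    obtain Q where "open_cover n W Q" "(\<Inter>k\<le>Suc n. Q k) = {}" "\<And>k. k \<le> Suc n \<Longrightarrow> Q k \<inter> A = T k"
      by (rule extend_open_cover_along_map[where S = T and A = A and n = n, OF nW W(3) TA AT Tempty a(1) aT]) (assumption+, rule that, simp_all)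
    then show thesis using T that[of Q] by (simp add: is_cover_def)
  next
    assume cl: "closed_cover n X1 S1 \<and> closed_cover n X2 S2"
    obtain U1 where U1: "\<And>k. k \<le> Suc n \<Longrightarrow> S1 k \<subseteq> U1 k" "(\<Inter>k\<le>Suc n. U1 k) = {}"
      "f1 \<in> open_cover_class n v X1 U1"
      by (rule cover_class_imp_open_cover[OF f(1) empty(1)]) (use that in blast)
    obtain U2 where U2: "\<And>k. k \<le> Suc n \<Longrightarrow> S2 k \<subseteq> U2 k" "(\<Inter>k\<le>Suc n. U2 k) = {}"
      "f2 \<in> open_cover_class n v X2 U2"
      by (rule cover_class_imp_open_cover[OF f(2) empty(2)]) (use that in blast)
    obtain \<Phi>1 where \<Phi>1: "carried_by n X1 U1 \<Phi>1"
      "homotopic_with (\<lambda>_. True) X1 (sphere_top n v) (simplex_point n v \<circ> \<Phi>1) f1"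
      by (rule open_cover_class_carried_by[OF U1(3,2)])
    obtain \<Phi>2 where \<Phi>2: "carried_by n X2 U2 \<Phi>2"
      "homotopic_with (\<lambda>_. True) X2 (sphere_top n v) (simplex_point n v \<circ> \<Phi>2) f2"
      by (rule open_cover_class_carried_by[OF U2(3,2)])
    define U where "U k = e1 ` (U1 k \<inter> topspace X1) \<union> e2 ` (U2 k \<inter> topspace X2)" for k
    obtain a where a: "continuous_map W (simplex_boundary n) a"
      "\<forall>w\<in>A. \<forall>k\<le>Suc n. a w k \<noteq> 0 \<longrightarrow> w \<in> U k"
      using carried[OF \<Phi>1(1) \<Phi>2(1) \<Phi>1(2) \<Phi>2(2)] unfolding U_def by blast
    have aU: "w \<in> U k" if "w \<in> A" "k \<le> Suc n" "a w k \<noteq> 0" for w k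
      using a(2) that by blast
    have clT: "closedin W (T k)" if "k \<le> Suc n" for k
      unfolding T_def using cl that
      by (intro closedin_Un closed_embedding_image[OF e1] closed_embedding_image[OF e2])
        (auto simp: closed_cover_def)
    have A: "A = (\<Union>k\<le>Suc n. T k)"
      unfolding A_def T_def cover[symmetric] by blast
    have TU: "T k \<subseteq> U k" if "k \<le> Suc n" for k
      using U1(1)[OF that] U2(1)[OF that] SX[OF that] unfolding T_def U_def by blast
    have "(\<Inter>k\<le>Suc n. U1 k \<inter> topspace X1) = {}" "(\<Inter>k\<le>Suc n. U2 k \<inter> topspace X2) = {}"
      by (rule Inter_empty_mono[OF U1(2)], simp) (rule Inter_empty_mono[OF U2(2)], simp)
    then have Uempty: "(\<Inter>k\<le>Suc n. U k) = {}"
      unfolding U_def by (intro Inter_glued_empty[OF inj disj]) auto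
    obtain Q where "closed_cover n W Q" "(\<Inter>k\<le>Suc n. Q k) = {}" "\<And>k. k \<le> Suc n \<Longrightarrow> Q k \<inter> A = T k"
      by (rule extend_closed_cover_along_map[where S = T and U = U and n = n, OF nW W(3) clT A a(1) TU Uempty aU]) (assumption+, rule that, simp_all)
    then show thesis using T that[of Q] by (simp add: is_cover_def)
  qed
qed

text \<open>
  The boundary parts of a cobordism are closed because they are continuous images of compact spaces
  in a Hausdorff space.
\<close>

lemma cobordism_closed_embeddings:
  assumes cob: "cobordism W M1 e1 M2 e2" and M: "compact_space (mtop M1)" "compact_space (mtop M2)"
  shows "compact_space (mtop W)" "Hausdorff_space (mtop W)" "second_countable (mtop W)"
    "embedding_map (mtop M1) (mtop W) e1" "closedin (mtop W) (e1 ` mcarrier M1)"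
    "embedding_map (mtop M2) (mtop W) e2" "closedin (mtop W) (e2 ` mcarrier M2)"
    "disjnt (e1 ` mcarrier M1) (e2 ` mcarrier M2)"
proof -
  show W: "compact_space (mtop W)" "Hausdorff_space (mtop W)" "second_countable (mtop W)"
    using cob by (auto simp: cobordism_def compact_oriented_manifold_def oriented_manifold_def)
  show e: "embedding_map (mtop M1) (mtop W) e1" "embedding_map (mtop M2) (mtop W) e2"
    using cob by (auto simp: cobordism_def oriented_embedding_def boundary_mfd_def
        reverse_orientation_def embedding_map_in_subtopology)
  show "closedin (mtop W) (e1 ` mcarrier M1)" "closedin (mtop W) (e2 ` mcarrier M2)"
    using M by (auto intro!: compactin_imp_closedin[OF W(2)] intro: image_compactin
        embedding_imp_continuous_map[OF e(1)] embedding_imp_continuous_map[OF e(2)]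
        simp: compact_space_def)
  show "disjnt (e1 ` mcarrier M1) (e2 ` mcarrier M2)"
    using cob by (simp add: cobordism_def disjnt_def)
qed

theorem theorem3p4:
  fixes n :: nat and v :: "nat \<Rightarrow> nat \<Rightarrow> real"
    and M1 :: "'a mfd" and M2 :: "'b mfd"
    and S1 :: "nat \<Rightarrow> 'a set" and S2 :: "nat \<Rightarrow> 'b set"
    and f1 :: "'a \<Rightarrow> nat \<Rightarrow> real" and f2 :: "'b \<Rightarrow> nat \<Rightarrow> real"
  assumes "simplex_vertices n v"
    and "compact_oriented_manifold M1" and "mboundary M1 = {}"
    and "compact_oriented_manifold M2" and "mboundary M2 = {}"
    and "mtop M1 homotopy_equivalent_space mtop M2"
    and "open_cover n (mtop M1) S1 \<and> open_cover n (mtop M2) S2 \<or>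
         closed_cover n (mtop M1) S1 \<and> closed_cover n (mtop M2) S2"
    and "(\<Inter>i\<le>Suc n. S1 i) = {}" and "(\<Inter>i\<le>Suc n. S2 i) = {}"
    and "f1 \<in> cover_class n v (mtop M1) S1" and "f2 \<in> cover_class n v (mtop M2) S2"
  shows "cobordant_covers n M1 S1 M2 S2 \<longleftrightarrow> cobordant_maps (sphere_top n v) M1 f1 M2 f2"
proof -
  have M: "compact_space (mtop M1)" "normal_space (mtop M1)"
    "compact_space (mtop M2)" "normal_space (mtop M2)"
    using assms(2,4)
    by (auto simp: compact_oriented_manifold_def oriented_manifold_def
        intro: compact_Hausdorff_or_regular_imp_normal_space)
  note S = assms(7) and empty = assms(8,9) and f = assms(10,11)
  show ?thesis
  proof
    assume "cobordant_covers n M1 S1 M2 S2"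
    then obtain W e1 e2 Q where W: "cobordism W M1 e1 M2 e2"
      and Q0: "is_cover n (mtop W) Q" "\<forall>k\<le>Suc n. {x \<in> mcarrier M1. e1 x \<in> Q k} = S1 k"
        "\<forall>k\<le>Suc n. {x \<in> mcarrier M2. e2 x \<in> Q k} = S2 k" "(\<Inter>k\<le>Suc n. Q k) = {}"
      unfolding cobordant_covers_def by (elim exE conjE) (rule that)
    have Q: "{x \<in> mcarrier M1. e1 x \<in> Q k} = S1 k" "{x \<in> mcarrier M2. e2 x \<in> Q k} = S2 k"
      if "k \<le> Suc n" for k
      using Q0 that by simp_all
    note c = cobordism_closed_embeddings[OF W M(1,3)]
    obtain F where "continuous_map (mtop W) (sphere_top n v) F"
      "\<And>x. x \<in> mcarrier M1 \<Longrightarrow> F (e1 x) = f1 x" "\<And>x. x \<in> mcarrier M2 \<Longrightarrow> F (e2 x) = f2 x"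
      by (rule extended_cover_imp_extended_map[OF assms(1) c(1,2) M(2,4) c(4-8) f Q0(1,4) Q]) (assumption+, rule that, simp_all)
    then show "cobordant_maps (sphere_top n v) M1 f1 M2 f2"
      using W unfolding cobordant_maps_def by blast
  next
    assume "cobordant_maps (sphere_top n v) M1 f1 M2 f2"
    then obtain W e1 e2 F where W: "cobordism W M1 e1 M2 e2"
      and F: "continuous_map (mtop W) (sphere_top n v) F"
        "\<forall>x\<in>mcarrier M1. F (e1 x) = f1 x" "\<forall>x\<in>mcarrier M2. F (e2 x) = f2 x"
      unfolding cobordant_maps_def by (elim exE conjE) (rule that)
    note c = cobordism_closed_embeddings[OF W M(1,3)]
    obtain Q where "is_cover n (mtop W) Q" "(\<Inter>k\<le>Suc n. Q k) = {}"
      "\<And>k. k \<le> Suc n \<Longrightarrow> {x \<in> mcarrier M1. e1 x \<in> Q k} = S1 k"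
      "\<And>k. k \<le> Suc n \<Longrightarrow> {x \<in> mcarrier M2. e2 x \<in> Q k} = S2 k"
      by (rule extended_map_imp_extended_cover[where F = F and ?e1.0 = e1 and ?e2.0 = e2 and ?f1.0 = f1
            and ?f2.0 = f2, OF assms(1) c(1-3) M(2,4) c(4-8) S empty f F(1) bspec[OF F(2)] bspec[OF F(3)]]) (assumption+, rule that, simp_all)
    then show "cobordant_covers n M1 S1 M2 S2"
      using W unfolding cobordant_covers_def by blast
  qed
qed

end
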